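(* Let $T$ be a finite set of subgraph types and, for each $n$, let $G_u$ be a random graph of size $n$ generated by the unweighted subgraph generated model $\mathrm{uSUGM}(n,T,p)$ with probabilities $p(\cdot,\cdot)$, and let $A_u$ be its adjacency matrix. Denote by $\Delta_u := \|\mathbb{E}[A_u]\|_{\infty}$ the maximum expected degree and by $M := \max_{t\in T} m_t$ the maximum subgraph size. Let also $\Delta_w := \|\mathbb{E}[A_w]\|_\infty$, where $A_w$ is the adjacency matrix of the weighted model $\mathrm{wSUGM}(n,T,p)$ with the same $T$ and $p$. Let $\epsilon>0$ and suppose that, for some scalar $\mu_{T,p}$ independent of $n$, for $n$ sufficiently large, $$\frac{\Delta_w}{\Delta_u}\le \mu_{T,p}\qquad\text{and}\qquad \Delta_u > \frac{16}{\mu_{T,p}}\ln(2n/\epsilon).$$ Then, for $n$ sufficiently large, with probability at least $1-\epsilon$, $$\|A_u-\mathbb{E}[A_u]\|_2 \le 4M^2\sqrt{\mu_{T,p}\,\Delta_u\,\ln(2n/\epsilon)}.$$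
   Context: Subgraph types. $T$ is a finite nonempty set of types, fixed independently of $n$. Each type $t\in T$ is a fixed nonempty (i.e. having at least one edge) undirected simple graph on $m_t$ nodes. For $n\ge m_t$, $\mathfrak{S}(n,m_t)$ denotes the set of all ordered lists $L=[v_1,\dots,v_{m_t}]$ of $m_t$ distinct nodes of $\{1,\dots,n\}$, and $g_t(L)$ is the copy of the type-$t$ graph placed on the nodes of $L$ in the given order (its $a$-th node is identified with $v_a$). $A(t,L)\in\{0,1\}^{n\times n}$ is the symmetric adjacency matrix of $g_t(L)$: $A(t,L)_{ij}=A(t,L)_{ji}=1$ iff $i,j\in L$ and $(i,j)$ is an edge of $g_t(L)$. Models. For each $n$, probabilities $p(t,L)\in[0,1]$ are given for all $t\in T$, $L\in\mathfrak{S}(n,m_t)$ (they may depend on $n$). Let $x(t,L)\sim\mathrm{Bernoulli}(p(t,L))$ be mutually independent (each subgraph $g_t(L)$ is formed independently with probability $p(t,L)$). The weighted model $\mathrm{wSUGM}(n,T,p)$ has adjacency matrix $A_w=\sum_{t\in T}\sum_{L\in\mathfrak{S}(n,m_t)} x(t,L)A(t,L)$. The unweighted model $\mathrm{uSUGM}(n,T,p)$ has adjacency matrix $A_u\in\{0,1\}^{n\times n}$ with $(A_u)_{ij}=\min\{(A_w)_{ij},1\}$, i.e. $(A_u)_{ij}=1$ iff edge $(i,j)$ belongs to at least one formed subgraph. Norms: $\|\cdot\|_2$ is the spectral norm and $\|\cdot\|_\infty$ the maximum absolute row sum norm of a matrix. *)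

theory Defs
  imports
    "HOL-Probability.Probability"
    "Graph_Theory.Pair_Digraph"
    "Jordan_Normal_Form.Matrix"
begin

text \<open>
  Matrices of size \<open>n\<close> by \<open>n\<close>, with \<open>n\<close> an ordinary variable, are the matrices of
  Jordan_Normal_Form. Rows and columns are numbered from 0, so the nodes of a graph of size
  \<open>n\<close> are \<open>0, ..., n - 1\<close>.
\<close>

no_notation vec_nth (infixl \<open>$\<close> 90)

definition euclidean_norm :: "real vec \<Rightarrow> real" where
  "euclidean_norm v = L2_set (\<lambda>i. v $ i) {..<dim_vec v}"

text \<open>The operator norm induced by the Euclidean norm.\<close>

definition spectral_norm :: "real mat \<Rightarrow> real" where
  "spectral_norm A =
     (SUP v \<in> {v \<in> carrier_vec (dim_col A). euclidean_norm v \<le> 1}. euclidean_norm (A *\<^sub>v v))"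

definition max_row_sum_norm :: "real mat \<Rightarrow> real" where
  "max_row_sum_norm A = (MAX i \<in> {..<dim_row A}. \<Sum>j<dim_col A. \<bar>A $$ (i, j)\<bar>)"

definition expected_matrix :: "'w measure \<Rightarrow> nat \<Rightarrow> ('w \<Rightarrow> real mat) \<Rightarrow> real mat" where
  "expected_matrix \<Omega> n A = mat n n (\<lambda>(i, j). \<integral>\<omega>. A \<omega> $$ (i, j) \<partial>\<Omega>)"

text \<open>
  The locale \<^locale>\<open>pair_graph\<close> describes finite simple undirected graphs, each edge being
  represented by both of its orientations. The vertices of a subgraph type are numbered from 0,
  so that vertex \<open>a\<close> is placed on the list entry \<open>L ! a\<close>.
\<close>

definition subgraph_type :: "nat pair_pre_digraph \<Rightarrow> bool" where
  "subgraph_type G \<longleftrightarrow>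
     pair_graph G \<and> pverts G = {..<card (pverts G)} \<and> parcs G \<noteq> {}"

definition node_lists :: "nat \<Rightarrow> nat \<Rightarrow> nat list set" where
  "node_lists n m = {L. distinct L \<and> length L = m \<and> set L \<subseteq> {..<n}}"

definition subgraph_copy :: "nat pair_pre_digraph \<Rightarrow> nat list \<Rightarrow> nat pair_pre_digraph" where
  "subgraph_copy G L =
     \<lparr> pverts = set L, parcs = (\<lambda>(a, b). (L ! a, L ! b)) ` parcs G \<rparr>"

definition adjacency_matrix :: "nat \<Rightarrow> nat pair_pre_digraph \<Rightarrow> real mat" where
  "adjacency_matrix n G = mat n n (\<lambda>(i, j). of_bool ((i, j) \<in> parcs G))"

definition subgraph_slots :: "nat \<Rightarrow> 't set \<Rightarrow> ('t \<Rightarrow> nat pair_pre_digraph) \<Rightarrow> ('t \<times> nat list) set" where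
  "subgraph_slots n T g = (SIGMA t:T. node_lists n (card (pverts (g t))))"

text \<open>
  \<open>x (t, L)\<close> is the event that the copy of \<open>g t\<close> on \<open>L\<close> is formed. The same family \<open>x\<close>
  drives the weighted and the unweighted model.
\<close>

definition sugm_formation ::
  "nat \<Rightarrow> 't set \<Rightarrow> ('t \<Rightarrow> nat pair_pre_digraph) \<Rightarrow> ('t \<Rightarrow> nat list \<Rightarrow> real) \<Rightarrow>
   'w measure \<Rightarrow> ('t \<times> nat list \<Rightarrow> 'w \<Rightarrow> bool) \<Rightarrow> bool" where
  "sugm_formation n T g p \<Omega> x \<longleftrightarrow>
     prob_space \<Omega> \<and>
     prob_space.indep_vars \<Omega> (\<lambda>_. count_space UNIV) x (subgraph_slots n T g) \<and>
     (\<forall>(t, L) \<in> subgraph_slots n T g.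
        distr \<Omega> (count_space UNIV) (x (t, L)) = measure_pmf (bernoulli_pmf (p t L)))"

definition weighted_adjacency ::
  "nat \<Rightarrow> 't set \<Rightarrow> ('t \<Rightarrow> nat pair_pre_digraph) \<Rightarrow> ('t \<times> nat list \<Rightarrow> 'w \<Rightarrow> bool) \<Rightarrow>
   'w \<Rightarrow> real mat" where
  "weighted_adjacency n T g x \<omega> =
     mat n n (\<lambda>(i, j). \<Sum>t\<in>T. \<Sum>L\<in>node_lists n (card (pverts (g t))).
       of_bool (x (t, L) \<omega>) * adjacency_matrix n (subgraph_copy (g t) L) $$ (i, j))"

definition unweighted_adjacency ::
  "nat \<Rightarrow> 't set \<Rightarrow> ('t \<Rightarrow> nat pair_pre_digraph) \<Rightarrow> ('t \<times> nat list \<Rightarrow> 'w \<Rightarrow> bool) \<Rightarrow>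
   'w \<Rightarrow> real mat" where
  "unweighted_adjacency n T g x \<omega> =
     mat n n (\<lambda>(i, j). min (weighted_adjacency n T g x \<omega> $$ (i, j)) 1)"

end

theory Submission
  imports Defs
begin

text \<open>
  The unweighted adjacency matrix is a function of the independent indicators of the slots, and
  adding the copy in slot \<open>s\<close> changes it by a symmetric matrix dominated entrywise by the adjacency
  matrix of that copy. Revealing the slots one at a time therefore gives a matrix martingale whose
  conditional variances are dominated by fixed diagonal matrices \<open>V\<^sub>s\<close> with
  \<open>\<parallel>\<Sum>\<^sub>s V\<^sub>s\<parallel> \<le> M\<^sup>2 \<Delta>\<^sub>w\<close>, and the theorem is a Freedman inequality for this martingale.

  As in Oliveira's proof of the matrix Freedman inequality, the compensators \<open>4 \<theta>\<^sup>2 V\<^sub>s\<close> are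
  subtracted inside the trace exponential, so that each step is controlled by Golden-Thompson alone
  and Lieb's theorem is not needed. Instead of \<open>tr (exp H)\<close> the potential is
  \<open>tr ((1 + H/N)\<^sup>N)\<close> with \<open>N = 2\<^sup>k\<close>. For it, Golden-Thompson becomes the inequality
  \<open>tr ((PQ)\<^sup>N) \<le> tr (P\<^sup>N Q\<^sup>N)\<close> for symmetric \<open>P\<close> and \<open>Q\<close>, which only needs Cauchy-Schwarz,
  up to an error \<open>O(1/N)\<close> that disappears as \<open>k \<rightarrow> \<infinity>\<close>.
\<close>

section \<open>Trace inequalities in a tracial algebra with involution\<close>

text \<open>The truncation \<open>min _ 1\<close> makes \<open>A\<^sub>u\<close> a nonlinear
  function of the indicators, so it is not a sum of independent matrices and Bernstein bounds for
  such sums do not apply to it. Its increments are only known to be dominated by the copies; this is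
  why the variance is measured by \<open>\<Delta>\<^sub>w\<close>, and the ratio hypothesis is what
  turns it into \<open>\<mu> * \<Delta>\<^sub>u\<close>. In each compensator one half pays for the
  variance of the increment and the other half for the square of the compensator itself. This works
  when \<open>\<theta> * M \<le> 1 / 4\<close>, which the lower bound on
  \<open>\<Delta>\<^sub>u\<close> guarantees for the optimal \<open>\<theta>\<close>. Exponents that
  are powers of two serve twice: doubling drives the Cauchy-Schwarz induction, and an even power of
  a symmetric matrix is a square, hence monotone inside a trace. No filtration is built. Outcomes
  are subsets of a finite index set, revealing a slot is one insertion in an induction, and
  conditional expectations are means over the remaining subsets. Largest eigenvalues are replaced by
  positive functionals, so no spectral theorem is used.\<close>

lemma power_two_power_Suc: "x ^ 2 ^ k * x ^ 2 ^ k = (x ^ 2 ^ Suc k :: 'a::monoid_mult)"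
  by (subst power_Suc, subst mult_2, subst power_add, rule refl)

text \<open>\<open>tr\<close> is only positive semidefinite. It will be the trace of a single
  component of a family of matrices, and a nonzero family may vanish in that component. All
  estimates are therefore stated through a seminorm.\<close>

locale tracial_algebra =
  fixes star :: "'a::real_algebra_1 \<Rightarrow> 'a" and tr :: "'a \<Rightarrow> real"
  assumes linear_star: "linear star"
    and star_mult: "star (a * b) = star b * star a"
    and star_star [simp]: "star (star a) = a"
    and linear_tr: "linear tr"
    and tr_mult_commute: "tr (a * b) = tr (b * a)"
    and tr_star: "tr (star a) = tr a"
    and tr_nonneg: "0 \<le> tr (star a * a)"
begin

lemmas star_add = linear_add[OF linear_star]
lemmas star_diff = linear_diff[OF linear_star]
lemmas star_scaleR = linear_scale[OF linear_star]
lemmas star_sum = linear_sum[OF linear_star]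
lemmas star_zero [simp] = linear_0[OF linear_star]
lemmas tr_add = linear_add[OF linear_tr]
lemmas tr_diff = linear_diff[OF linear_tr]
lemmas tr_scaleR = linear_scale[OF linear_tr]
lemmas tr_zero [simp] = linear_0[OF linear_tr]

lemma star_one [simp]: "star 1 = 1"
  by (metis mult_1 mult.right_neutral star_mult star_star)

lemma star_power: "star (a ^ m) = star a ^ m"
  by (induction m) (simp_all add: star_mult power_commutes)

definition selfadjoint :: "'a \<Rightarrow> bool" where
  "selfadjoint a \<longleftrightarrow> star a = a"

lemma selfadjointD: "selfadjoint a \<Longrightarrow> star a = a"
  by (simp add: selfadjoint_def)

lemma selfadjoint_one [simp]: "selfadjoint 1"
  and selfadjoint_zero [simp]: "selfadjoint 0"
  and selfadjoint_add: "selfadjoint a \<Longrightarrow> selfadjoint b \<Longrightarrow> selfadjoint (a + b)"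
  and selfadjoint_diff: "selfadjoint a \<Longrightarrow> selfadjoint b \<Longrightarrow> selfadjoint (a - b)"
  and selfadjoint_scaleR: "selfadjoint a \<Longrightarrow> selfadjoint (c *\<^sub>R a)"
  and selfadjoint_power: "selfadjoint a \<Longrightarrow> selfadjoint (a ^ m)"
  and selfadjoint_star_mult: "selfadjoint (star b * b)"
  and selfadjoint_mult_star: "selfadjoint (b * star b)"
  by (simp_all add: selfadjoint_def star_add star_diff star_scaleR star_power star_mult)

lemma selfadjoint_sum: "(\<And>i. i \<in> I \<Longrightarrow> selfadjoint (f i)) \<Longrightarrow> selfadjoint (sum f I)"
  by (simp add: selfadjoint_def star_sum)

lemmas selfadjoint_intros = selfadjoint_add selfadjoint_diff selfadjoint_scaleR
  selfadjoint_power selfadjoint_sum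

section \<open>The trace seminorm and Cauchy-Schwarz\<close>

lemma tr_mult_star_commute: "tr (star a * b) = tr (star b * a)"
  using tr_star[of "star a * b"] by (simp add: star_mult)

definition nrm :: "'a \<Rightarrow> real" where
  "nrm a = sqrt (tr (star a * a))"

lemma nrm_nonneg [simp]: "0 \<le> nrm a"
  by (simp add: nrm_def tr_nonneg)

lemma nrm_power2: "(nrm a)\<^sup>2 = tr (star a * a)"
  by (simp add: nrm_def tr_nonneg)

lemma Cauchy_Schwarz: "\<bar>tr (star a * b)\<bar> \<le> nrm a * nrm b"
proof -
  let ?A = "tr (star a * a)" and ?B = "tr (star b * b)" and ?C = "tr (star a * b)"
  have quad: "0 \<le> ?A - 2 * s * ?C + s\<^sup>2 * ?B" for s
  proof -
    have "0 \<le> tr (star (a - s *\<^sub>R b) * (a - s *\<^sub>R b))"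
      by (rule tr_nonneg)
    also have "\<dots> = ?A - 2 * s * ?C + s\<^sup>2 * ?B"
      using tr_mult_star_commute[of b a]
      by (simp add: star_diff star_scaleR tr_diff tr_add tr_scaleR algebra_simps power2_eq_square)
    finally show ?thesis .
  qed
  have "?C\<^sup>2 \<le> ?A * ?B"
  proof (cases "?B = 0")
    case True
    have "?C = 0"
    proof (rule ccontr)
      assume "?C \<noteq> 0"
      \<comment> \<open>As \<open>tr\<close> need not be faithful, \<open>?B = 0\<close> does not
        give \<open>b = 0\<close>. Without its quadratic term, \<open>quad\<close> takes the value
        -1 at this \<open>s\<close>.\<close>
      with quad[of "(?A + 1) / (2 * ?C)"] True show False
        by simp
    qed
    then show ?thesis using True by simp
  next
    case False
    then have "?B > 0"
      using tr_nonneg[of b] by simp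
    have "0 \<le> ?B * (?A - 2 * (?C / ?B) * ?C + (?C / ?B)\<^sup>2 * ?B)"
      using quad[of "?C / ?B"] \<open>?B > 0\<close> by simp
    also have "\<dots> = ?A * ?B - ?C\<^sup>2"
      using False by (simp add: field_simps power2_eq_square)
    finally show ?thesis by simp
  qed
  then have "sqrt (?C\<^sup>2) \<le> sqrt (?A * ?B)"
    by (rule real_sqrt_le_mono)
  then show ?thesis
    by (simp add: nrm_def real_sqrt_mult)
qed

lemma nrm_star: "nrm (star a) = nrm a"
  unfolding nrm_def by (simp add: tr_mult_commute)

lemma nrm_scaleR: "nrm (c *\<^sub>R a) = \<bar>c\<bar> * nrm a"
  unfolding nrm_def
  by (simp add: star_scaleR tr_scaleR real_sqrt_mult flip: real_sqrt_abs mult.assoc power2_eq_square)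

lemma nrm_add: "nrm (a + b) \<le> nrm a + nrm b"
proof -
  have "(nrm (a + b))\<^sup>2 = (nrm a)\<^sup>2 + (nrm b)\<^sup>2 + 2 * tr (star a * b)"
    using tr_mult_star_commute[of b a]
    by (simp add: nrm_power2 star_add tr_add algebra_simps)
  also have "\<dots> \<le> (nrm a + nrm b)\<^sup>2"
    using Cauchy_Schwarz[of a b] by (simp add: power2_sum)
  finally show ?thesis
    by (rule power2_le_imp_le) simp
qed

lemma nrm_zero [simp]: "nrm 0 = 0"
  by (simp add: nrm_def)

lemma nrm_add_power2: "(nrm (a + b))\<^sup>2 \<le> 2 * (nrm a)\<^sup>2 + 2 * (nrm b)\<^sup>2"
proof -
  have "(nrm (a + b))\<^sup>2 \<le> (nrm a + nrm b)\<^sup>2"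
    by (intro power_mono nrm_add) simp
  also have "\<dots> \<le> 2 * (nrm a)\<^sup>2 + 2 * (nrm b)\<^sup>2"
    using sum_squares_bound[of "nrm a" "nrm b"] by (simp add: power2_sum)
  finally show ?thesis .
qed

lemma nrm_diff_power2: "(nrm (a - b))\<^sup>2 \<le> 2 * (nrm a)\<^sup>2 + 2 * (nrm b)\<^sup>2"
  using nrm_add_power2[of a "- 1 *\<^sub>R b"] by (simp only: nrm_scaleR) simp

text \<open>This bounds the operator norm of left multiplication with respect to \<open>nrm\<close>.
  For the trace of \<open>n\<close> by \<open>n\<close> matrices that norm is the spectral norm,
  although \<open>nrm\<close> is the Hilbert-Schmidt norm.\<close>

definition opbound :: "'a \<Rightarrow> real \<Rightarrow> bool" where
  "opbound a c \<longleftrightarrow> 0 \<le> c \<and> (\<forall>x. nrm (a * x) \<le> c * nrm x)"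

lemma opboundD: "opbound a c \<Longrightarrow> nrm (a * x) \<le> c * nrm x"
  and opbound_nonneg: "opbound a c \<Longrightarrow> 0 \<le> c"
  by (simp_all add: opbound_def)

lemma opbound_one: "opbound 1 1"
  by (simp add: opbound_def)

lemma opbound_zero: "opbound 0 0"
  by (simp add: opbound_def)

lemma opbound_mono: "opbound a c \<Longrightarrow> c \<le> d \<Longrightarrow> opbound a d"
  unfolding opbound_def by (meson mult_right_mono nrm_nonneg order_trans)

lemma opbound_add:
  assumes "opbound a c" "opbound b d"
  shows "opbound (a + b) (c + d)"
proof -
  have "nrm ((a + b) * x) \<le> (c + d) * nrm x" for x
    using nrm_add[of "a * x" "b * x"] opboundD[OF assms(1), of x] opboundD[OF assms(2), of x]
    by (simp add: algebra_simps)
  then show ?thesis using assms by (simp add: opbound_def)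
qed

lemma opbound_mult:
  assumes "opbound a c" "opbound b d"
  shows "opbound (a * b) (c * d)"
proof -
  have "nrm (a * b * x) \<le> c * d * nrm x" for x
  proof -
    have "nrm (a * (b * x)) \<le> c * nrm (b * x)"
      by (rule opboundD[OF assms(1)])
    also have "\<dots> \<le> c * (d * nrm x)"
      by (intro mult_left_mono opboundD[OF assms(2)] opbound_nonneg[OF assms(1)])
    finally show ?thesis by (simp add: mult.assoc)
  qed
  then show ?thesis using assms by (simp add: opbound_def)
qed

lemma opbound_scaleR: "opbound a c \<Longrightarrow> opbound (s *\<^sub>R a) (\<bar>s\<bar> * c)"
  by (simp add: opbound_def nrm_scaleR mult.assoc mult_left_mono)

lemma opbound_diff: "opbound a c \<Longrightarrow> opbound b d \<Longrightarrow> opbound (a - b) (c + d)"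
  using opbound_add[of a c "- 1 *\<^sub>R b" d] opbound_scaleR[of b d "-1"] by simp

lemma opbound_power: "opbound a c \<Longrightarrow> opbound (a ^ m) (c ^ m)"
  by (induction m) (simp_all add: opbound_one opbound_mult)

lemma tr_le_opbound:
  assumes "opbound a c"
  shows "\<bar>tr a\<bar> \<le> c * tr 1"
proof -
  have "\<bar>tr (star 1 * a)\<bar> \<le> nrm 1 * nrm (a * 1)"
    using Cauchy_Schwarz[of 1 a] by simp
  also have "\<dots> \<le> nrm 1 * (c * nrm 1)"
    by (intro mult_left_mono opboundD[OF assms]) simp
  also have "\<dots> = c * tr 1"
    using nrm_power2[of 1] by (simp add: power2_eq_square mult_ac)
  finally show ?thesis by simp
qed

text \<open>Telescoping one factor at a time. It is used with \<open>m = N\<close>,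
  \<open>c = 1 + O(1/N)\<close> and \<open>d = O(1/N^2)\<close>, where the bound is
  \<open>O(1/N)\<close>.\<close>

lemma opbound_power_diff:
  assumes "opbound a c" "opbound b c" "opbound (a - b) d"
  shows "opbound (a ^ m - b ^ m) (real m * d * c ^ (m - 1))"
proof (induction m)
  case 0
  then show ?case by (simp add: opbound_zero)
next
  case (Suc m)
  have "a ^ Suc m - b ^ Suc m = a * (a ^ m - b ^ m) + (a - b) * b ^ m"
    by (simp add: algebra_simps)
  moreover have "opbound (a * (a ^ m - b ^ m) + (a - b) * b ^ m)
      (c * (real m * d * c ^ (m - 1)) + d * c ^ m)"
    by (intro opbound_add opbound_mult opbound_power assms Suc)
  moreover have "c * (real m * d * c ^ (m - 1)) + d * c ^ m = real (Suc m) * d * c ^ (Suc m - 1)"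
    by (cases m) (simp_all add: algebra_simps)
  ultimately show ?case by simp
qed

lemma tr_power_mult_commute: "tr ((a * b) ^ m) = tr ((b * a) ^ m)"
proof (cases m)
  case (Suc k)
  have comm: "(a * b) ^ k * a = a * (b * a) ^ k"
    by (induction k) (simp_all add: mult.assoc)
  have "tr ((a * b) ^ m) = tr ((a * b) ^ k * a * b)"
    by (simp only: Suc power_Suc2 mult.assoc)
  also have "\<dots> = tr (b * (a * (b * a) ^ k))"
    by (simp add: comm tr_mult_commute[of "_ * _" b])
  finally show ?thesis
    by (simp add: Suc mult.assoc)
qed simp

text \<open>
  The induction is joint: the second inequality for \<open>Suc j\<close> follows from the first one for \<open>j\<close> with
  \<open>z = p q\<close>, and the first one for \<open>Suc j\<close> from both for \<open>j\<close>, applied to \<open>z\<^sup>2\<close> and to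
  \<open>p = z z\<^sup>*\<close>, \<open>q = z\<^sup>* z\<close>.
\<close>

lemma tr_mult_power_le:
  "\<bar>tr (z ^ (2 * 2 ^ j))\<bar> \<le> tr ((star z * z) ^ 2 ^ j)"
  "selfadjoint p \<Longrightarrow> selfadjoint q \<Longrightarrow> tr ((p * q) ^ 2 ^ j) \<le> tr (p ^ 2 ^ j * q ^ 2 ^ j)"
proof (induction j arbitrary: z p q)
  case 0
  {
    case (1 z)
    have "\<bar>tr (star (star z) * z)\<bar> \<le> nrm (star z) * nrm z"
      by (rule Cauchy_Schwarz)
    also have "\<dots> = tr (star z * z)"
      by (simp add: nrm_star flip: nrm_power2 power2_eq_square)
    finally show ?case
      by (simp add: power2_eq_square)
  next
    case (2 p q)
    show ?case by simp
  }
next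
  case (Suc j)
  {
    case (1 z)
    let ?u = "z * star z" and ?v = "star z * z"
    have sa: "selfadjoint ?u" "selfadjoint ?v"
      by (rule selfadjoint_mult_star selfadjoint_star_mult)+
    have sa': "star (?u ^ 2 ^ j) = ?u ^ 2 ^ j" "star (?v ^ 2 ^ j) = ?v ^ 2 ^ j"
      using sa by (simp_all add: selfadjoint_def star_power)
    have nrm_pow: "(nrm (y ^ 2 ^ j))\<^sup>2 = tr (y ^ 2 ^ Suc j)" if "star (y ^ 2 ^ j) = y ^ 2 ^ j" for y
      by (simp only: nrm_power2 that power_two_power_Suc)
    \<comment> \<open>By cyclicity \<open>z * star z\<close> and \<open>star z * z\<close> have the
      same power traces, so the two factors of the final Cauchy-Schwarz step are equal and multiply
      to one trace.\<close>
    have "(nrm (?u ^ 2 ^ j))\<^sup>2 = (nrm (?v ^ 2 ^ j))\<^sup>2"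
      by (simp only: nrm_pow sa' tr_power_mult_commute[of z "star z" "2 ^ Suc j"])
    then have nrm_eq: "nrm (?u ^ 2 ^ j) = nrm (?v ^ 2 ^ j)"
      by (rule power2_eq_imp_eq) simp_all
    have "\<bar>tr (z ^ (2 * 2 ^ Suc j))\<bar> = \<bar>tr ((z * z) ^ (2 * 2 ^ j))\<bar>"
      by (simp only: power_mult[of z 2] power2_eq_square power_Suc[of "2::nat"])
    also have "\<dots> \<le> tr ((star (z * z) * (z * z)) ^ 2 ^ j)"
      by (rule Suc)
    also have "\<dots> = tr ((?u * ?v) ^ 2 ^ j)"
      using tr_power_mult_commute[of "star z" "star z * z * z" "2 ^ j"]
        tr_power_mult_commute[of "?v" "?u" "2 ^ j"]
      by (simp add: star_mult mult.assoc)
    also have "\<dots> \<le> tr (?u ^ 2 ^ j * ?v ^ 2 ^ j)"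
      by (intro Suc sa)
    also have "\<dots> \<le> nrm (?u ^ 2 ^ j) * nrm (?v ^ 2 ^ j)"
      using Cauchy_Schwarz[of "?u ^ 2 ^ j" "?v ^ 2 ^ j"] by (simp add: sa')
    also have "\<dots> = tr (?v ^ 2 ^ Suc j)"
      using nrm_pow[OF sa'(2)] by (simp only: nrm_eq power2_eq_square)
    finally show ?case .
  next
    case (2 p q)
    then have sa: "star p = p" "star q = q"
      by (simp_all add: selfadjoint_def)
    have "tr ((p * q) ^ 2 ^ Suc j) \<le> \<bar>tr ((p * q) ^ (2 * 2 ^ j))\<bar>"
      by simp
    also have "\<dots> \<le> tr ((star (p * q) * (p * q)) ^ 2 ^ j)"
      by (rule Suc)
    also have "\<dots> = tr ((p ^ 2 * q ^ 2) ^ 2 ^ j)"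
      using tr_power_mult_commute[of q "p * p * q" "2 ^ j"]
      by (simp add: star_mult sa mult.assoc power2_eq_square)
    also have "\<dots> \<le> tr ((p ^ 2) ^ 2 ^ j * (q ^ 2) ^ 2 ^ j)"
      using 2 by (intro Suc selfadjoint_power)
    also have "\<dots> = tr (p ^ 2 ^ Suc j * q ^ 2 ^ Suc j)"
      by (simp flip: power_mult)
    finally show ?case .
  }
qed

section \<open>One step of the potential\<close>

text \<open>For selfadjoint elements and the trace of \<open>n\<close> by \<open>n\<close> matrices
  this is the Loewner order of the components at \<open>n\<close>.\<close>

definition ople :: "'a \<Rightarrow> 'a \<Rightarrow> bool" where
  "ople a b \<longleftrightarrow> (\<forall>x. tr (star x * a * x) \<le> tr (star x * b * x))"

lemma opleD: "ople a b \<Longrightarrow> tr (star x * a * x) \<le> tr (star x * b * x)"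
  by (simp add: ople_def)

lemma tr_conj_square: "selfadjoint a \<Longrightarrow> tr (star x * (a * a) * x) = (nrm (a * x))\<^sup>2"
  by (simp add: nrm_power2 star_mult selfadjoint_def mult.assoc)

text \<open>Taylor expansion with the quadratic remainder kept between two factors \<open>w\<close>,
  so that a norm bound on \<open>r\<close> alone suffices to compare it with \<open>w * w\<close>.
  The recursion \<open>r' = m + r + r * w\<close> is also that of the scalar remainder at
  \<open>w = s\<close>, which gives the bound.\<close>

lemma one_plus_power_expansion:
  assumes "opbound w s" "0 < s"
  shows "\<exists>r. opbound r (((1 + s) ^ m - 1 - real m * s) / s\<^sup>2) \<and>
    (1 + w) ^ m = 1 + real m *\<^sub>R w + w * r * w"
proof (induction m)
  case 0
  show ?case
    by (rule exI[of _ 0]) (simp add: opbound_zero)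
next
  case (Suc m)
  define \<rho> where "\<rho> = ((1 + s) ^ m - 1 - real m * s) / s\<^sup>2"
  from Suc obtain r where r: "opbound r \<rho>" "(1 + w) ^ m = 1 + real m *\<^sub>R w + w * r * w"
    by (auto simp: \<rho>_def)
  have "(1 + w) ^ Suc m = 1 + real (Suc m) *\<^sub>R w + w * (real m *\<^sub>R 1 + r + r * w) * w"
    unfolding power_Suc2 r(2) by (simp add: algebra_simps)
  moreover have "opbound (real m *\<^sub>R 1 + r + r * w) (\<bar>real m\<bar> * 1 + \<rho> + \<rho> * s)"
    by (intro opbound_add opbound_mult opbound_scaleR opbound_one assms r)
  moreover have "\<bar>real m\<bar> * 1 + \<rho> + \<rho> * s = ((1 + s) ^ Suc m - 1 - real (Suc m) * s) / s\<^sup>2"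
    using assms(2) by (simp add: \<rho>_def field_simps power2_eq_square)
  ultimately show ?case by metis
qed

text \<open>The finite counterpart of \<open>exp y \<le> 1 + y + y^2\<close>. For
  \<open>s = 1 / m\<close> the scalar remainder is \<open>(1 + s) ^ m - 2\<close>, at most
  \<open>exp 1 - 2 \<le> 1\<close>.\<close>

lemma one_plus_power_ople:
  assumes y: "selfadjoint y" "opbound y 1" and m: "0 < m"
  shows "ople ((1 + (1 / real m) *\<^sub>R y) ^ m) (1 + y + y * y)"
proof -
  define s where "s = 1 / real m"
  have s: "0 < s" "real m * s = 1"
    using m by (simp_all add: s_def)
  have "opbound (s *\<^sub>R y) s"
    using opbound_scaleR[OF y(2), of s] s by simp
  from one_plus_power_expansion[OF this s(1), of m] obtain r where
    r: "opbound r (((1 + s) ^ m - 2) / s\<^sup>2)"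
      "(1 + s *\<^sub>R y) ^ m = 1 + y + (s *\<^sub>R y) * r * (s *\<^sub>R y)"
    using s by auto
  have "(1 + s) ^ m \<le> exp s ^ m"
    using s by (intro power_mono) (simp_all add: exp_ge_add_one_self)
  also have "\<dots> = exp 1"
    using s by (simp flip: exp_of_nat_mult)
  finally have "(1 + s) ^ m - 2 \<le> 1"
    using exp_le by simp
  then have "((1 + s) ^ m - 2) / s\<^sup>2 \<le> 1 / s\<^sup>2"
    by (intro divide_right_mono) simp_all
  with r(1) have "opbound r (1 / s\<^sup>2)"
    by (rule opbound_mono)
  from opbound_scaleR[OF this, of "s\<^sup>2"] have r': "opbound (s\<^sup>2 *\<^sub>R r) 1"
    using s by simp
  have "tr (star x * ((s *\<^sub>R y) * r * (s *\<^sub>R y)) * x) \<le> tr (star x * (y * y) * x)" for x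
  proof -
    have "tr (star x * ((s *\<^sub>R y) * r * (s *\<^sub>R y)) * x) = tr (star (y * x) * ((s\<^sup>2 *\<^sub>R r) * (y * x)))"
      using y(1) by (simp add: star_mult selfadjoint_def mult.assoc power2_eq_square)
    also have "\<dots> \<le> nrm (y * x) * nrm ((s\<^sup>2 *\<^sub>R r) * (y * x))"
      using Cauchy_Schwarz by (rule abs_le_D1)
    also have "\<dots> \<le> nrm (y * x) * (1 * nrm (y * x))"
      by (intro mult_left_mono opboundD[OF r']) simp
    also have "\<dots> = tr (star x * (y * y) * x)"
      using tr_conj_square[OF y(1)] by (simp add: power2_eq_square)
    finally show ?thesis .
  qed
  then show ?thesis
    unfolding s_def[symmetric] r(2) by (simp add: ople_def algebra_simps tr_add)
qed

definition pot :: "nat \<Rightarrow> 'a \<Rightarrow> real" where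
  "pot k h = tr ((1 + (1 / 2 ^ k) *\<^sub>R h) ^ 2 ^ k)"

text \<open>The substitute for Golden-Thompson. Half of \<open>y\<close> is placed on each side of
  the factor with \<open>h\<close>, as \<open>1 + y / (2 N)\<close>; cyclicity joins the two halves
  to a square, whence the exponent \<open>2 * 2 ^ k\<close>.\<close>

lemma pot_add_le:
  assumes h: "selfadjoint h" "opbound h a" and y: "selfadjoint y" "opbound y 1"
  shows "pot k (h + y) \<le> tr ((1 + (1 / 2 ^ k) *\<^sub>R h) ^ 2 ^ k *
      (1 + (1 / real (2 * 2 ^ k)) *\<^sub>R y) ^ (2 * 2 ^ k)) +
    (1 + 5 * a) * exp (a + 1) * tr 1 / 2 ^ k"
proof -
  define N :: nat where "N = 2 ^ k"
  define e where "e = 1 / (2 * real N)"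
  define B where "B = 1 + (2 * e) *\<^sub>R h"
  define Q where "Q = 1 + e *\<^sub>R y"
  define R where "R = B + (2 * e) *\<^sub>R y"
    \<comment> \<open>\<open>Q B Q\<close> agrees with \<open>R\<close> up to \<open>O(e\<^sup>2)\<close>, and \<open>tr ((Q B Q)\<^sup>N) = tr ((B Q\<^sup>2)\<^sup>N)\<close>.\<close>
  define c where "c = exp (2 * e * (a + 1))"
  have N: "0 < N" "1 \<le> N" by (simp_all add: N_def)
  have e: "0 < e" "e \<le> 1 / 2" "2 * e * real N = 1" "2 * e = 1 / 2 ^ k" "e = 1 / real (2 * 2 ^ k)"
    using N by (simp_all add: e_def field_simps N_def)
  have a: "0 \<le> a" using h(2) by (rule opbound_nonneg)
  have sa: "selfadjoint B" "selfadjoint Q"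
    unfolding B_def Q_def by (intro selfadjoint_intros h y selfadjoint_one)+
  have bB: "opbound B (1 + \<bar>2 * e\<bar> * a)" and bQ: "opbound Q (1 + \<bar>e\<bar> * 1)"
    unfolding B_def Q_def by (intro opbound_add opbound_one opbound_scaleR h y)+
  have bR: "opbound R c"
  proof (rule opbound_mono)
    show "opbound R (1 + \<bar>2 * e\<bar> * a + \<bar>2 * e\<bar> * 1)"
      unfolding R_def by (intro opbound_add bB opbound_scaleR y)
    have "1 + \<bar>2 * e\<bar> * a + \<bar>2 * e\<bar> * 1 = 1 + 2 * e * (a + 1)"
      using e(1) by (simp add: distrib_left)
    also have "\<dots> \<le> c"
      unfolding c_def by (rule exp_ge_add_one_self)
    finally show "1 + \<bar>2 * e\<bar> * a + \<bar>2 * e\<bar> * 1 \<le> c" .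
  qed
  have bQBQ: "opbound (Q * B * Q) c"
  proof (rule opbound_mono)
    show "opbound (Q * B * Q) ((1 + \<bar>e\<bar> * 1) * (1 + \<bar>2 * e\<bar> * a) * (1 + \<bar>e\<bar> * 1))"
      by (intro opbound_mult bB bQ)
    have "(1 + \<bar>e\<bar> * 1) * (1 + \<bar>2 * e\<bar> * a) * (1 + \<bar>e\<bar> * 1) \<le> exp e * exp (2 * e * a) * exp e"
      using e a exp_ge_add_one_self[of e] exp_ge_add_one_self[of "2 * e * a"]
      by (intro mult_mono) auto
    also have "\<dots> = c"
      unfolding c_def by (simp flip: exp_add add: algebra_simps)
    finally show "(1 + \<bar>e\<bar> * 1) * (1 + \<bar>2 * e\<bar> * a) * (1 + \<bar>e\<bar> * 1) \<le> c" .
  qed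
  have diff: "Q * B * Q - R = e\<^sup>2 *\<^sub>R (y * y) + (2 * e\<^sup>2) *\<^sub>R (y * h + h * y) + (2 * e ^ 3) *\<^sub>R (y * h * y)"
    by (simp add: Q_def R_def B_def algebra_simps power2_eq_square power3_eq_cube flip: scaleR_2)
  \<comment> \<open>Since \<open>y\<close> has norm at most 1 and \<open>h\<close> at most
    \<open>a\<close>, the terms of \<open>diff\<close> contribute \<open>e^2\<close>,
    \<open>4 e^2 a\<close> and \<open>2 e^3 a\<close>; the last is at most \<open>e^2 a\<close>
    because \<open>e \<le> 1 / 2\<close>.\<close>
  have bdiff: "opbound (R - Q * B * Q) (e\<^sup>2 * (1 + 5 * a))"
  proof (rule opbound_mono)
    have "opbound (Q * B * Q - R) (\<bar>e\<^sup>2\<bar> * (1 * 1) + \<bar>2 * e\<^sup>2\<bar> * (1 * a + a * 1) + \<bar>2 * e ^ 3\<bar> * (1 * a * 1))"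
      unfolding diff by (intro opbound_add opbound_mult opbound_scaleR h y)
    from opbound_scaleR[OF this, of "-1"]
    show "opbound (R - Q * B * Q) (\<bar>e\<^sup>2\<bar> * (1 * 1) + \<bar>2 * e\<^sup>2\<bar> * (1 * a + a * 1) + \<bar>2 * e ^ 3\<bar> * (1 * a * 1))"
      by simp
    have "2 * e ^ 3 * a \<le> e\<^sup>2 * a"
      using e(1,2) a mult_right_mono[of "2 * e" 1 "e\<^sup>2 * a"]
      by (simp add: power2_eq_square power3_eq_cube mult_ac)
    then show "\<bar>e\<^sup>2\<bar> * (1 * 1) + \<bar>2 * e\<^sup>2\<bar> * (1 * a + a * 1) + \<bar>2 * e ^ 3\<bar> * (1 * a * 1) \<le> e\<^sup>2 * (1 + 5 * a)"
      using e(1) by (simp add: algebra_simps)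
  qed
  have "tr (R ^ N) - tr ((Q * B * Q) ^ N) \<le> real N * (e\<^sup>2 * (1 + 5 * a)) * c ^ (N - 1) * tr 1"
    using tr_le_opbound[OF opbound_power_diff[OF bR bQBQ bdiff, of N]] by (simp add: tr_diff)
  also have "\<dots> \<le> (1 + 5 * a) * exp (a + 1) * tr 1 / 2 ^ k"
  proof -
    have "c ^ (N - 1) \<le> c ^ N"
      using e a by (intro power_increasing) (simp_all add: c_def)
    also have "\<dots> = exp (a + 1)"
      using arg_cong[OF e(3), of "\<lambda>z. exp (z * (a + 1))"]
      by (simp add: c_def mult_ac flip: exp_of_nat_mult)
    finally have c: "c ^ (N - 1) \<le> exp (a + 1)" .
    have "real N * e\<^sup>2 = (1 / 2 ^ k) / 4"
      using e N by (simp add: power2_eq_square e_def N_def)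
    also have "\<dots> \<le> 1 / 2 ^ k"
      by (simp only: divide_divide_eq_left) (intro divide_left_mono, simp_all)
    finally have "real N * e\<^sup>2 \<le> 1 / 2 ^ k" .
    then have "real N * e\<^sup>2 * ((1 + 5 * a) * c ^ (N - 1) * tr 1) \<le> 1 / 2 ^ k * ((1 + 5 * a) * exp (a + 1) * tr 1)"
      using c a tr_nonneg[of 1] by (intro mult_mono mult_nonneg_nonneg) (simp_all add: c_def)
    then show ?thesis by (simp add: mult_ac)
  qed
  finally have "tr (R ^ N) \<le> tr ((Q * B * Q) ^ N) + (1 + 5 * a) * exp (a + 1) * tr 1 / 2 ^ k"
    by simp
  also have "tr ((Q * B * Q) ^ N) = tr ((B * (Q * Q)) ^ N)"
    using tr_power_mult_commute[of Q "B * Q" N] by (simp add: mult.assoc)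
  also have "\<dots> \<le> tr (B ^ N * (Q * Q) ^ N)"
    unfolding N_def
    using sa by (intro tr_mult_power_le) (simp_all add: selfadjoint_def star_mult)
  also have "(Q * Q) ^ N = Q ^ (2 * N)"
    by (simp add: power_mult power2_eq_square)
  finally show ?thesis
    unfolding R_def B_def Q_def pot_def e(4) by (simp add: N_def scaleR_add_right add.assoc e(5))
qed

section \<open>Increments dominated by projections, and the Bernoulli step\<close>

definition projection :: "'a \<Rightarrow> bool" where
  "projection q \<longleftrightarrow> star q = q \<and> q * q = q"

lemma nrm_projection_power2: "projection q \<Longrightarrow> (nrm (q * x))\<^sup>2 = tr (star x * q * x)"
  using tr_conj_square[of q x] by (simp add: projection_def selfadjoint_def)

lemma opbound_projection:
  assumes "projection q"
  shows "opbound q 1"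
proof -
  have "projection (1 - q)"
    using assms by (simp add: projection_def star_diff algebra_simps)
  then have "0 \<le> tr (star x * (1 - q) * x)" for x
    by (metis nrm_projection_power2 zero_le_power2)
  then have "(nrm (q * x))\<^sup>2 \<le> (nrm x)\<^sup>2" for x
    using nrm_projection_power2[OF assms, of x] by (simp add: nrm_power2 algebra_simps tr_diff)
  then have "nrm (q * x) \<le> nrm x" for x
    by (rule power2_le_imp_le) simp
  then show ?thesis by (simp add: opbound_def)
qed

text \<open>For a projection \<open>q\<close> and \<open>\<beta> \<ge> 0\<close> the condition means
  \<open>d^2 \<le> \<beta>^2 q\<close> in the order \<open>ople\<close>. Stated with norms, it is
  convex by the triangle inequality.\<close>

definition influences :: "real \<Rightarrow> 'a \<Rightarrow> 'a set" where
  "influences \<beta> q = {d. selfadjoint d \<and> (\<forall>x. nrm (d * x) \<le> \<beta> * nrm (q * x))}"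

text \<open>Martingale increments are averages of the changes caused by one slot over the slots not
  yet revealed; convexity carries the bound over to them.\<close>

lemma convex_influences: "convex (influences \<beta> q)"
proof (rule convexI)
  fix c d :: 'a and u v :: real
  assume cd: "c \<in> influences \<beta> q" "d \<in> influences \<beta> q" and uv: "0 \<le> u" "0 \<le> v" "u + v = 1"
  have "nrm ((u *\<^sub>R c + v *\<^sub>R d) * x) \<le> \<beta> * nrm (q * x)" for x
  proof -
    have "nrm ((u *\<^sub>R c + v *\<^sub>R d) * x) \<le> u * nrm (c * x) + v * nrm (d * x)"
      using nrm_add[of "u *\<^sub>R (c * x)" "v *\<^sub>R (d * x)"] uv by (simp add: algebra_simps nrm_scaleR)
    also have "\<dots> \<le> u * (\<beta> * nrm (q * x)) + v * (\<beta> * nrm (q * x))"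
      using cd uv by (intro add_mono mult_left_mono) (auto simp: influences_def)
    finally show ?thesis
      using uv by (simp flip: distrib_right)
  qed
  then show "u *\<^sub>R c + v *\<^sub>R d \<in> influences \<beta> q"
    using cd by (simp add: influences_def selfadjoint_intros)
qed

text \<open>\<open>y (1 - p)\<close> and \<open>y (- p)\<close> are the increments for success and
  failure, less the compensator \<open>c q\<close> with \<open>c = 4 \<theta>^2 \<beta>^2 p\<close>.
  The centred variable \<open>s\<close> has mean 0 and variance \<open>p (1 - p)\<close>, so
  \<open>1 + y + y^2\<close> averages to at most
  \<open>1 + (2 \<theta>^2 \<beta>^2 p + 2 c^2 - c) q\<close>. This is at most 1: the first term is
  \<open>c / 2\<close>, and \<open>2 c^2 \<le> c / 2\<close> as
  \<open>c \<le> 1 / 4\<close>.\<close>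

lemma pot_bernoulli_step:
  fixes \<theta> \<beta> p :: real
  assumes h: "selfadjoint h" "opbound h a" and d: "d \<in> influences \<beta> q" and q: "projection q"
    and \<beta>: "0 \<le> \<beta>" and \<theta>: "0 \<le> \<theta>" "\<theta> * \<beta> \<le> 1 / 4" and p: "0 \<le> p" "p \<le> 1" and k: "0 < k"
  defines "y \<equiv> \<lambda>s. (\<theta> * s) *\<^sub>R d - (4 * \<theta>\<^sup>2 * \<beta>\<^sup>2 * p) *\<^sub>R q"
  shows "selfadjoint (y (- p))" "selfadjoint (y (1 - p))" "opbound (y (- p)) 1" "opbound (y (1 - p)) 1"
    "(1 - p) * pot k (h + y (- p)) + p * pot k (h + y (1 - p))
      \<le> pot k h + (1 + 5 * a) * exp (a + 1) * tr 1 / 2 ^ k"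
proof -
  define c where "c = 4 * \<theta>\<^sup>2 * \<beta>\<^sup>2 * p"
  have "(\<theta> * \<beta>)\<^sup>2 \<le> (1 / 4)\<^sup>2"
    using \<theta> \<beta> by (intro power_mono) simp_all
  then have \<theta>\<beta>: "\<theta>\<^sup>2 * \<beta>\<^sup>2 \<le> 1 / 16"
    by (simp add: power_mult_distrib) (simp add: power2_eq_square)
  have "c \<le> 4 * (1 / 16) * 1"
    unfolding c_def using \<theta>\<beta> p mult_mono[OF \<theta>\<beta>, of p 1] by simp
  then have c: "0 \<le> c" "c \<le> 1 / 4"
    using p by (simp_all add: c_def)
  have sq: "selfadjoint q" and sd: "selfadjoint d" and dq: "nrm (d * x) \<le> \<beta> * nrm (q * x)" for x
    using q d by (simp_all add: projection_def selfadjoint_def influences_def)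
  have sy: "selfadjoint (y s)" for s
    unfolding y_def by (intro selfadjoint_intros sq sd)
  then show "selfadjoint (y (- p))" "selfadjoint (y (1 - p))" by blast+
  have "nrm (d * x) \<le> \<beta> * nrm x" for x
    using dq[of x] mult_left_mono[OF opboundD[OF opbound_projection[OF q]] \<beta>, of x] by simp
  then have bd: "opbound d \<beta>"
    using \<beta> by (simp add: opbound_def)
  have by1: "opbound (y s) 1" if "\<bar>s\<bar> \<le> 1" for s
  proof (rule opbound_mono)
    show "opbound (y s) (\<bar>\<theta> * s\<bar> * \<beta> + \<bar>c\<bar> * 1)"
      unfolding y_def c_def by (intro opbound_diff opbound_scaleR bd opbound_projection q)
    have "\<bar>\<theta> * s\<bar> * \<beta> = (\<theta> * \<beta>) * \<bar>s\<bar>"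
      using \<theta> by (simp add: abs_mult)
    also have "\<dots> \<le> (1 / 4) * 1"
      using \<theta> \<beta> that by (intro mult_mono) simp_all
    finally show "\<bar>\<theta> * s\<bar> * \<beta> + \<bar>c\<bar> * 1 \<le> 1" using c by simp
  qed
  show b: "opbound (y (- p)) 1" "opbound (y (1 - p)) 1"
    using p by (intro by1; simp)+
  define N :: nat where "N = 2 ^ k"
  define B where "B = 1 + (1 / 2 ^ k) *\<^sub>R h"
  define Z where "Z s = (1 + (1 / real (2 * 2 ^ k)) *\<^sub>R y s) ^ (2 * 2 ^ k)" for s
  define W where "W = (1 - p) *\<^sub>R Z (- p) + p *\<^sub>R Z (1 - p)"
  have Z: "ople (Z s) (1 + y s + y s * y s)" if "\<bar>s\<bar> \<le> 1" for s
    unfolding Z_def by (intro one_plus_power_ople sy by1 that) simp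
  have "tr (star x * W * x) \<le> tr (star x * x)" for x
  proof -
    define n2 where "n2 = (nrm (q * x))\<^sup>2"
    define t where "t = tr (star x * d * x)"
    have Zx: "tr (star x * Z s * x) \<le> tr (star x * x) + \<theta> * s * t - c * n2 +
        (2 * (\<theta>\<^sup>2 * \<beta>\<^sup>2 * s\<^sup>2) + 2 * c\<^sup>2) * n2" if "\<bar>s\<bar> \<le> 1" for s
    proof -
      have "(nrm (d * x))\<^sup>2 \<le> (\<beta> * nrm (q * x))\<^sup>2"
        by (intro power_mono dq) simp
      then have dn: "(nrm (d * x))\<^sup>2 \<le> \<beta>\<^sup>2 * n2"
        by (simp add: n2_def power_mult_distrib)
      have "y s * x = (\<theta> * s) *\<^sub>R (d * x) - c *\<^sub>R (q * x)"
        by (simp add: y_def c_def algebra_simps)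
      \<comment> \<open>Splitting the square at the price of a factor 2 avoids the mixed products of
        \<open>d\<close> and \<open>q\<close>.\<close>
      then have "(nrm (y s * x))\<^sup>2 \<le> 2 * (nrm ((\<theta> * s) *\<^sub>R (d * x)))\<^sup>2 + 2 * (nrm (c *\<^sub>R (q * x)))\<^sup>2"
        by (simp only: nrm_diff_power2)
      also have "\<dots> = 2 * (\<theta>\<^sup>2 * s\<^sup>2 * (nrm (d * x))\<^sup>2) + 2 * c\<^sup>2 * n2"
        by (simp add: nrm_scaleR power_mult_distrib n2_def)
      also have "\<dots> \<le> 2 * (\<theta>\<^sup>2 * s\<^sup>2 * (\<beta>\<^sup>2 * n2)) + 2 * c\<^sup>2 * n2"
        using dn by (intro add_mono mult_left_mono) simp_all
      finally have yn: "(nrm (y s * x))\<^sup>2 \<le> (2 * (\<theta>\<^sup>2 * \<beta>\<^sup>2 * s\<^sup>2) + 2 * c\<^sup>2) * n2"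
        by (simp add: algebra_simps)
      have "tr (star x * Z s * x) \<le> tr (star x * (1 + y s + y s * y s) * x)"
        by (rule opleD[OF Z[OF that]])
      also have "\<dots> = tr (star x * x) + tr (star x * y s * x) + tr (star x * (y s * y s) * x)"
        by (simp add: algebra_simps tr_add)
      also have "tr (star x * y s * x) = \<theta> * s * t - c * n2"
        using nrm_projection_power2[OF q, of x]
        by (simp add: y_def c_def n2_def t_def algebra_simps tr_diff tr_scaleR)
      finally show ?thesis
        using yn tr_conj_square[OF sy, of x s] by simp
    qed
    have n2: "0 \<le> n2" by (simp add: n2_def)
    have "tr (star x * W * x) = (1 - p) * tr (star x * Z (- p) * x) + p * tr (star x * Z (1 - p) * x)"
      by (simp add: W_def distrib_left distrib_right tr_add tr_scaleR)
    also have "\<dots> \<le> (1 - p) * (tr (star x * x) + \<theta> * (- p) * t - c * n2 +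
        (2 * (\<theta>\<^sup>2 * \<beta>\<^sup>2 * (- p)\<^sup>2) + 2 * c\<^sup>2) * n2) + p * (tr (star x * x) + \<theta> * (1 - p) * t - c * n2 +
        (2 * (\<theta>\<^sup>2 * \<beta>\<^sup>2 * (1 - p)\<^sup>2) + 2 * c\<^sup>2) * n2)"
      using p by (intro add_mono mult_left_mono Zx) simp_all
    also have "\<dots> = tr (star x * x) + (2 * (\<theta>\<^sup>2 * \<beta>\<^sup>2 * p) * (1 - p) + 2 * c\<^sup>2 - c) * n2"
      by (simp add: power2_eq_square algebra_simps)
    also have "\<dots> \<le> tr (star x * x) + 0 * n2"
    proof -
      have "2 * (\<theta>\<^sup>2 * \<beta>\<^sup>2 * p) * (1 - p) \<le> 2 * (\<theta>\<^sup>2 * \<beta>\<^sup>2 * p) * 1"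
        using p by (intro mult_left_mono) simp_all
      moreover have "c\<^sup>2 \<le> (1 / 4) * c"
        unfolding power2_eq_square using c by (intro mult_right_mono) simp_all
      ultimately have "2 * (\<theta>\<^sup>2 * \<beta>\<^sup>2 * p) * (1 - p) + 2 * c\<^sup>2 - c \<le> 0"
        by (simp add: c_def)
      then show ?thesis
        using n2 by (intro add_left_mono mult_right_mono)
    qed
    finally show ?thesis by simp
  qed
  note W = this
  \<comment> \<open>An even exponent lets \<open>B ^ N\<close> be split as \<open>G * G\<close>.
    Then \<open>tr (B ^ N * W) = tr (G * W * G)\<close>, where the order bound on \<open>W\<close>
    applies.\<close>
  obtain l where l: "k = Suc l" using k by (cases k) auto
  define G where "G = B ^ 2 ^ l"
  have BG: "B ^ 2 ^ k = G * G"
    unfolding G_def l by (rule power_two_power_Suc[symmetric])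
  have sG: "star G = G"
    unfolding G_def B_def using h by (simp add: star_power star_add star_scaleR selfadjoint_def)
  have BZ: "tr (B ^ 2 ^ k * z) = tr (star G * z * G)" for z
    using tr_mult_commute[of G "G * z"] by (simp add: BG sG mult.assoc)
  define E where "E = (1 + 5 * a) * exp (a + 1) * tr 1 / 2 ^ k"
  have "(1 - p) * pot k (h + y (- p)) + p * pot k (h + y (1 - p))
      \<le> (1 - p) * (tr (B ^ 2 ^ k * Z (- p)) + E) + p * (tr (B ^ 2 ^ k * Z (1 - p)) + E)"
    unfolding Z_def B_def E_def
    using p by (intro add_mono mult_left_mono pot_add_le h sy b) simp_all
  also have "\<dots> = tr (B ^ 2 ^ k * W) + E"
    by (simp only: W_def distrib_left tr_add tr_scaleR mult_scaleR_right) (simp add: algebra_simps)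
  also have "\<dots> \<le> pot k h + E"
    using W[of G] BZ[of 1] by (simp add: BZ[of W] pot_def flip: B_def)
  finally show "(1 - p) * pot k (h + y (- p)) + p * pot k (h + y (1 - p))
      \<le> pot k h + (1 + 5 * a) * exp (a + 1) * tr 1 / 2 ^ k"
    by (simp only: E_def)
qed

end

section \<open>A tail bound for functions of independent Bernoulli variables\<close>

text \<open>An outcome of the Bernoulli variables indexed by \<open>J\<close> is encoded by its set \<open>S \<subseteq> J\<close> of successes.\<close>

definition bernoulli_weight :: "('s \<Rightarrow> real) \<Rightarrow> 's set \<Rightarrow> 's set \<Rightarrow> real" where
  "bernoulli_weight p J S = (\<Prod>j\<in>S. p j) * (\<Prod>j\<in>J - S. 1 - p j)"

definition bernoulli_mean :: "('s \<Rightarrow> real) \<Rightarrow> 's set \<Rightarrow> ('s set \<Rightarrow> 'b::real_vector) \<Rightarrow> 'b" where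
  "bernoulli_mean p J f = (\<Sum>S\<in>Pow J. bernoulli_weight p J S *\<^sub>R f S)"

lemma bernoulli_mean_empty [simp]: "bernoulli_mean p {} f = f {}"
  by (simp add: bernoulli_mean_def bernoulli_weight_def)

text \<open>Conditioning on the variable \<open>j\<close>: the two means over \<open>J\<close> are
  the conditional expectations given its failure and its success.\<close>

lemma bernoulli_mean_insert:
  assumes "finite J" "j \<notin> J"
  shows "bernoulli_mean p (insert j J) f =
    (1 - p j) *\<^sub>R bernoulli_mean p J f + p j *\<^sub>R bernoulli_mean p J (\<lambda>S. f (insert j S))"
proof -
  have w0: "bernoulli_weight p (insert j J) S = (1 - p j) * bernoulli_weight p J S" if "S \<in> Pow J" for S
  proof -
    have "insert j J - S = insert j (J - S)" "j \<notin> J - S" using assms that by auto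
    then show ?thesis using assms by (simp add: bernoulli_weight_def)
  qed
  have w1: "bernoulli_weight p (insert j J) (insert j S) = p j * bernoulli_weight p J S" if "S \<in> Pow J" for S
  proof -
    have "insert j J - insert j S = J - S" "j \<notin> S" "finite S"
      using assms that by (auto intro: finite_subset)
    then show ?thesis by (simp add: bernoulli_weight_def)
  qed
  have "inj_on (insert j) (Pow J)"
    using assms by (auto simp: inj_on_def)
  have "bernoulli_mean p (insert j J) f =
      (\<Sum>S\<in>Pow J. bernoulli_weight p (insert j J) S *\<^sub>R f S) +
      (\<Sum>S\<in>insert j ` Pow J. bernoulli_weight p (insert j J) S *\<^sub>R f S)"
    unfolding bernoulli_mean_def Pow_insert using assms by (intro sum.union_disjoint) auto
  also have "\<dots> = (\<Sum>S\<in>Pow J. bernoulli_weight p (insert j J) S *\<^sub>R f S) +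
      (\<Sum>S\<in>Pow J. bernoulli_weight p (insert j J) (insert j S) *\<^sub>R f (insert j S))"
    using \<open>inj_on (insert j) (Pow J)\<close> by (simp add: sum.reindex)
  also have "\<dots> = (1 - p j) *\<^sub>R bernoulli_mean p J f + p j *\<^sub>R bernoulli_mean p J (\<lambda>S. f (insert j S))"
    by (simp add: bernoulli_mean_def scaleR_sum_right w0 w1)
  finally show ?thesis .
qed

lemma bernoulli_weight_nonneg:
  assumes "\<And>j. j \<in> J \<Longrightarrow> p j \<in> {0..1}" "S \<subseteq> J"
  shows "0 \<le> bernoulli_weight p J S"
  unfolding bernoulli_weight_def using assms by (intro mult_nonneg_nonneg prod_nonneg) auto

lemma bernoulli_mean_mono:
  fixes f g :: "'s set \<Rightarrow> real"
  assumes "\<And>j. j \<in> J \<Longrightarrow> p j \<in> {0..1}" "\<And>S. S \<subseteq> J \<Longrightarrow> f S \<le> g S"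
  shows "bernoulli_mean p J f \<le> bernoulli_mean p J g"
  unfolding bernoulli_mean_def using assms
  by (intro sum_mono) (auto intro!: mult_left_mono bernoulli_weight_nonneg)

lemma bernoulli_mean_const:
  assumes "finite J"
  shows "bernoulli_mean p J (\<lambda>_. c) = c"
  using assms by (induction J) (simp_all add: bernoulli_mean_insert flip: scaleR_add_left)

lemma bernoulli_mean_diff:
  "bernoulli_mean p J (\<lambda>S. f S - g S) = bernoulli_mean p J f - bernoulli_mean p J g"
  by (simp add: bernoulli_mean_def scaleR_diff_right sum_subtractf)

lemma bernoulli_mean_add:
  "bernoulli_mean p J (\<lambda>S. f S + g S) = bernoulli_mean p J f + bernoulli_mean p J g"
  by (simp add: bernoulli_mean_def scaleR_add_right sum.distrib)

lemma bernoulli_mean_cmult: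
  fixes f :: "'s set \<Rightarrow> real"
  shows "bernoulli_mean p J (\<lambda>S. c * f S) = c * bernoulli_mean p J f"
  by (simp add: bernoulli_mean_def sum_distrib_left mult_ac)

lemma bernoulli_mean_minus: "bernoulli_mean p J (\<lambda>S. - f S) = - bernoulli_mean p J f"
  by (simp add: bernoulli_mean_def sum_negf)

lemma bernoulli_mean_linear:
  assumes "linear L"
  shows "L (bernoulli_mean p J f) = bernoulli_mean p J (\<lambda>S. L (f S))"
  unfolding bernoulli_mean_def by (simp add: linear_sum[OF assms] linear_scale[OF assms])

lemma bernoulli_mean_cong:
  "(\<And>S. S \<subseteq> J \<Longrightarrow> f S = g S) \<Longrightarrow> bernoulli_mean p J f = bernoulli_mean p J g"
  unfolding bernoulli_mean_def by (intro sum.cong) auto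

lemma bernoulli_mean_member:
  assumes "finite J" "s \<in> J"
  shows "bernoulli_mean p J (\<lambda>S. of_bool (s \<in> S)) = p s"
proof -
  obtain K where K: "J = insert s K" "s \<notin> K" "finite K"
    using assms by (metis finite_insert mk_disjoint_insert)
  have "bernoulli_mean p K (\<lambda>S. of_bool (s \<in> S)) = bernoulli_mean p K (\<lambda>_. 0 :: real)"
    using K by (intro bernoulli_mean_cong) auto
  then show ?thesis
    using K by (simp add: bernoulli_mean_insert bernoulli_mean_const)
qed

lemma bernoulli_mean_sum:
  "bernoulli_mean p J (\<lambda>S. \<Sum>i\<in>I. f i S) = (\<Sum>i\<in>I. bernoulli_mean p J (f i))"
  unfolding bernoulli_mean_def scaleR_sum_right by (rule sum.swap)

lemma bernoulli_mean_in_convex: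
  assumes "finite J" "\<And>j. j \<in> J \<Longrightarrow> p j \<in> {0..1}" "convex C" "\<And>S. S \<subseteq> J \<Longrightarrow> f S \<in> C"
  shows "bernoulli_mean p J f \<in> C"
  unfolding bernoulli_mean_def
proof (rule convex_sum[OF _ assms(3)])
  show "(\<Sum>S\<in>Pow J. bernoulli_weight p J S) = 1"
    using bernoulli_mean_const[OF assms(1), of p "1::real"] by (simp add: bernoulli_mean_def)
qed (use assms in \<open>auto intro: bernoulli_weight_nonneg\<close>)

section \<open>The supermartingale induction and the tail bound\<close>

context tracial_algebra
begin

text \<open>The constant \<open>c\<close> may depend on \<open>a\<close> and \<open>J\<close>, but
  not on \<open>k\<close>, \<open>h\<close> or \<open>F\<close>. Independence of \<open>k\<close>
  makes the error vanish in the limit; uniformity in \<open>h\<close> and \<open>F\<close> is what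
  the induction needs, since revealing a variable changes both.\<close>

lemma bernoulli_mean_pot_le:
  fixes p :: "'s \<Rightarrow> real" and q :: "'s \<Rightarrow> 'a" and \<theta> \<beta> :: real
  defines "C \<equiv> \<lambda>j. (4 * \<theta>\<^sup>2 * \<beta>\<^sup>2 * p j) *\<^sub>R q j"
  assumes "finite J" "\<And>j. j \<in> J \<Longrightarrow> p j \<in> {0..1}" "\<And>j. j \<in> J \<Longrightarrow> projection (q j)"
    and \<theta>: "0 \<le> \<theta>" "0 \<le> \<beta>" "\<theta> * \<beta> \<le> 1 / 4"
  shows "\<exists>c. \<forall>k>0. \<forall>h F. selfadjoint h \<longrightarrow> opbound h a \<longrightarrow>
    (\<forall>j\<in>J. \<forall>S\<subseteq>J - {j}. F (insert j S) - F S \<in> influences \<beta> (q j)) \<longrightarrow>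
    bernoulli_mean p J (\<lambda>S. pot k (h + \<theta> *\<^sub>R (F S - bernoulli_mean p J F) - (\<Sum>j\<in>J. C j)))
      \<le> pot k h + c / 2 ^ k"
  using assms(2-4)
proof (induction J arbitrary: a rule: finite_induct)
  case empty
  then show ?case by (intro exI[of _ 0]) simp
next
  case (insert j J)
  \<comment> \<open>Revealing \<open>j\<close> adds to \<open>h\<close> an increment of norm at most
    1, so the induction hypothesis is taken at \<open>a + 1\<close>.\<close>
  from insert.IH[of "a + 1"] insert.prems obtain c where
    c: "bernoulli_mean p J (\<lambda>S. pot k (h + \<theta> *\<^sub>R (F S - bernoulli_mean p J F) - (\<Sum>j\<in>J. C j)))
      \<le> pot k h + c / 2 ^ k"
    if "0 < k" "selfadjoint h" "opbound h (a + 1)"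
      "\<And>j S. j \<in> J \<Longrightarrow> S \<subseteq> J - {j} \<Longrightarrow> F (insert j S) - F S \<in> influences \<beta> (q j)" for k h F
    by (metis insertI2)
  show ?case
  proof (intro exI[of _ "c + (1 + 5 * a) * exp (a + 1) * tr 1"] allI impI)
    fix k :: nat and h :: 'a and F :: "'s set \<Rightarrow> 'a"
    assume k: "0 < k" and h: "selfadjoint h" "opbound h a"
      and "\<forall>i\<in>insert j J. \<forall>S\<subseteq>insert j J - {i}. F (insert i S) - F S \<in> influences \<beta> (q i)"
    then have F: "F (insert i S) - F S \<in> influences \<beta> (q i)"
      if "i \<in> insert j J" "S \<subseteq> insert j J - {i}" for i S
      using that by blast
    define F1 where "F1 S = F (insert j S)" for S
    define m0 m1 where "m0 = bernoulli_mean p J F" and "m1 = bernoulli_mean p J F1"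
    define m where "m = bernoulli_mean p (insert j J) F"
    define y where "y s = (\<theta> * s) *\<^sub>R (m1 - m0) - C j" for s
    have pj: "0 \<le> p j" "p j \<le> 1" using insert.prems(1)[of j] by auto
    have m: "m = (1 - p j) *\<^sub>R m0 + p j *\<^sub>R m1"
      using insert.hyps by (simp add: m_def m0_def m1_def F1_def[abs_def] bernoulli_mean_insert)
    have "bernoulli_mean p J (\<lambda>S. F1 S - F S) \<in> influences \<beta> (q j)"
      using insert.hyps insert.prems(1) F
      by (intro bernoulli_mean_in_convex convex_influences) (auto simp: F1_def)
    then have "m1 - m0 \<in> influences \<beta> (q j)"
      by (simp add: m0_def m1_def bernoulli_mean_diff)
    note step = pot_bernoulli_step[OF h this insert.prems(2)[OF insertI1] \<theta>(2,1,3) pj k,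
        folded C_def[THEN meta_eq_to_obj_eq, THEN fun_cong], folded y_def]
    have bd: "opbound (h + y (- p j)) (a + 1)" "opbound (h + y (1 - p j)) (a + 1)"
      by (intro opbound_add h step)+
    have sa: "selfadjoint (h + y (- p j))" "selfadjoint (h + y (1 - p j))"
      by (intro selfadjoint_intros h step)+
    \<comment> \<open>The Doob decomposition: the centred value given the outcome of
      \<open>j\<close>, plus the martingale increment \<open>s *\<^sub>R (m1 - m0)\<close> with
      \<open>s = - p j\<close> or \<open>s = 1 - p j\<close>.\<close>
    have F0: "F S - m = F S - m0 + (- p j) *\<^sub>R (m1 - m0)"
      and F1: "F1 S - m = F1 S - m1 + (1 - p j) *\<^sub>R (m1 - m0)" for S
      by (simp_all add: m algebra_simps)
    let ?D = "\<Sum>j\<in>J. C j" and ?E = "(1 + 5 * a) * exp (a + 1) * tr 1 / 2 ^ k"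
    have e0: "h + \<theta> *\<^sub>R (F S - m) - (\<Sum>j\<in>insert j J. C j) = h + y (- p j) + \<theta> *\<^sub>R (F S - m0) - ?D"
      and e1: "h + \<theta> *\<^sub>R (F1 S - m) - (\<Sum>j\<in>insert j J. C j) = h + y (1 - p j) + \<theta> *\<^sub>R (F1 S - m1) - ?D"
      for S
      unfolding F0 F1 y_def using insert.hyps by (simp_all add: scaleR_add_right scaleR_diff_right)
    have "bernoulli_mean p (insert j J) (\<lambda>S. pot k (h + \<theta> *\<^sub>R (F S - m) - (\<Sum>j\<in>insert j J. C j)))
      = (1 - p j) * bernoulli_mean p J (\<lambda>S. pot k (h + y (- p j) + \<theta> *\<^sub>R (F S - m0) - ?D)) +
        p j * bernoulli_mean p J (\<lambda>S. pot k (h + y (1 - p j) + \<theta> *\<^sub>R (F1 S - m1) - ?D))"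
      unfolding bernoulli_mean_insert[OF insert.hyps] F1_def[symmetric] unfolding e0 e1 by simp
    also have "\<dots> \<le> (1 - p j) * (pot k (h + y (- p j)) + c / 2 ^ k) +
        p j * (pot k (h + y (1 - p j)) + c / 2 ^ k)"
    proof (intro add_mono mult_left_mono)
      show "bernoulli_mean p J (\<lambda>S. pot k (h + y (- p j) + \<theta> *\<^sub>R (F S - m0) - ?D))
          \<le> pot k (h + y (- p j)) + c / 2 ^ k"
        unfolding m0_def by (intro c k bd sa F) (use insert.hyps in auto)
      show "bernoulli_mean p J (\<lambda>S. pot k (h + y (1 - p j) + \<theta> *\<^sub>R (F1 S - m1) - ?D))
          \<le> pot k (h + y (1 - p j)) + c / 2 ^ k"
        unfolding m1_def
      proof (intro c k bd sa)
        fix i S assume "i \<in> J" "S \<subseteq> J - {i}"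
        then show "F1 (insert i S) - F1 S \<in> influences \<beta> (q i)"
          unfolding F1_def insert_commute[of j i] using insert.hyps by (intro F) auto
      qed
    qed (use pj in simp_all)
    also have "\<dots> = (1 - p j) * pot k (h + y (- p j)) + p j * pot k (h + y (1 - p j)) + c / 2 ^ k"
      by (simp add: ring_distribs diff_divide_distrib)
    also have "\<dots> \<le> pot k h + (c / 2 ^ k + ?E)"
      using step(5) by linarith
    also have "\<dots> = pot k h + (c + (1 + 5 * a) * exp (a + 1) * tr 1) / 2 ^ k"
      by (simp add: add_divide_distrib)
    finally show "bernoulli_mean p (insert j J) (\<lambda>S. pot k (h + \<theta> *\<^sub>R (F S -
        bernoulli_mean p (insert j J) F) - (\<Sum>j\<in>insert j J. C j)))
      \<le> pot k h + (c + (1 + 5 * a) * exp (a + 1) * tr 1) / 2 ^ k"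
      by (simp only: m_def)
  qed
qed

text \<open>Every unit vector \<open>v\<close> gives such a functional through
  \<open>v^T A v\<close>. A state with \<open>t \<le> \<phi> H\<close> stands in for an eigenvalue
  of at least \<open>t\<close>; domination by \<open>tr\<close> on squares is what ties it to the
  potential.\<close>

definition state :: "('a \<Rightarrow> real) \<Rightarrow> bool" where
  "state \<phi> \<longleftrightarrow> linear \<phi> \<and> \<phi> 1 = 1 \<and> (\<forall>a. 0 \<le> \<phi> (star a * a) \<and> \<phi> (star a * a) \<le> tr (star a * a))"

lemma state_square_ge:
  assumes "state \<phi>" "selfadjoint a"
  shows "(\<phi> a)\<^sup>2 \<le> \<phi> (a\<^sup>2)"
proof -
  have lin: "linear \<phi>" and one: "\<phi> 1 = 1" using assms(1) by (simp_all add: state_def)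
  have "selfadjoint (a - \<phi> a *\<^sub>R 1)"
    by (intro selfadjoint_intros assms selfadjoint_one)
  then have "0 \<le> \<phi> ((a - \<phi> a *\<^sub>R 1) * (a - \<phi> a *\<^sub>R 1))"
    using assms(1) unfolding state_def selfadjoint_def by metis
  then show ?thesis
    by (simp add: algebra_simps linear_diff[OF lin] linear_add[OF lin] linear_scale[OF lin] one power2_eq_square)
qed

text \<open>Jensen's inequality obtained by iterating
  \<open>(\<phi> a)^2 \<le> \<phi> (a^2)\<close>; the sign of \<open>\<phi> a\<close> permits
  squaring the induction hypothesis.\<close>

lemma state_power_ge:
  assumes "state \<phi>" "selfadjoint a" "0 \<le> \<phi> a"
  shows "\<phi> a ^ 2 ^ k \<le> \<phi> (a ^ 2 ^ k)"
proof (induction k)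
  case (Suc k)
  have "\<phi> a ^ 2 ^ Suc k = (\<phi> a ^ 2 ^ k)\<^sup>2"
    by (simp add: mult.commute flip: power_mult)
  also have "\<dots> \<le> (\<phi> (a ^ 2 ^ k))\<^sup>2"
    using assms(3) Suc by (intro power_mono) simp_all
  also have "\<dots> \<le> \<phi> ((a ^ 2 ^ k)\<^sup>2)"
    by (intro state_square_ge selfadjoint_intros assms)
  also have "(a ^ 2 ^ k)\<^sup>2 = a ^ 2 ^ Suc k"
    by (simp add: mult.commute flip: power_mult)
  finally show ?case .
qed simp

text \<open>With \<open>N = 2 ^ k\<close> and \<open>B = 1 + h / N\<close>, the chain is \<open>(1 +
  t / N)^N \<le> \<phi> B ^ N \<le> \<phi> (B ^ N) \<le> tr (B ^ N)\<close>, by Jensen and then by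
  domination, as \<open>B ^ N\<close> is a square for even \<open>N\<close>.\<close>

lemma pot_nonneg:
  assumes "selfadjoint h" "0 < k"
  shows "0 \<le> pot k h"
    and "state \<phi> \<Longrightarrow> 0 \<le> t \<Longrightarrow> t \<le> \<phi> h \<Longrightarrow> (1 + t / 2 ^ k) ^ 2 ^ k \<le> pot k h"
proof -
  define B where "B = 1 + (1 / 2 ^ k) *\<^sub>R h"
  obtain l where l: "k = Suc l" using assms(2) by (cases k) auto
  have sB: "selfadjoint B"
    unfolding B_def by (intro selfadjoint_intros assms selfadjoint_one)
  have BG: "B ^ 2 ^ k = star (B ^ 2 ^ l) * B ^ 2 ^ l"
    unfolding l selfadjointD[OF selfadjoint_power[OF sB]] by (rule power_two_power_Suc[symmetric])
  show "0 \<le> pot k h"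
    unfolding pot_def B_def[symmetric] BG by (rule tr_nonneg)
  assume \<phi>: "state \<phi>" and t: "0 \<le> t" "t \<le> \<phi> h"
  have "\<phi> B = 1 + \<phi> h / 2 ^ k"
    using \<phi> unfolding B_def state_def by (simp add: linear_add linear_scale)
  then have \<phi>B: "1 + t / 2 ^ k \<le> \<phi> B" "0 \<le> \<phi> B"
    using t by (simp_all add: divide_right_mono)
  have "(1 + t / 2 ^ k) ^ 2 ^ k \<le> \<phi> B ^ 2 ^ k"
    using \<phi>B t by (intro power_mono) simp_all
  also have "\<dots> \<le> \<phi> (B ^ 2 ^ k)"
    by (intro state_power_ge \<phi> sB \<phi>B)
  also have "\<dots> \<le> tr (B ^ 2 ^ k)"
    using \<phi> unfolding BG by (simp add: state_def)
  finally show "(1 + t / 2 ^ k) ^ 2 ^ k \<le> pot k h"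
    by (simp add: pot_def B_def)
qed

text \<open>Markov's inequality for the potential started at \<open>h = 0\<close>, where its value
  is \<open>tr 1\<close>. As \<open>k\<close> grows, the threshold
  \<open>(1 + t / 2 ^ k) ^ 2 ^ k\<close> tends to \<open>exp t\<close> and the error
  \<open>c / 2 ^ k\<close> to 0.\<close>

theorem bernoulli_matrix_tail:
  fixes p :: "'s \<Rightarrow> real" and q :: "'s \<Rightarrow> 'a" and \<theta> \<beta> t :: real
  assumes J: "finite J" "\<And>j. j \<in> J \<Longrightarrow> p j \<in> {0..1}" "\<And>j. j \<in> J \<Longrightarrow> projection (q j)"
    and \<theta>: "0 \<le> \<theta>" "0 \<le> \<beta>" "\<theta> * \<beta> \<le> 1 / 4" and t: "0 \<le> t"
    and sa: "\<And>S. S \<subseteq> J \<Longrightarrow> selfadjoint (F S)"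
    and F: "\<And>j S. j \<in> J \<Longrightarrow> S \<subseteq> J - {j} \<Longrightarrow> F (insert j S) - F S \<in> influences \<beta> (q j)"
  shows "bernoulli_mean p J (\<lambda>S. of_bool (\<exists>\<phi>. state \<phi> \<and>
      t \<le> \<phi> (\<theta> *\<^sub>R (F S - bernoulli_mean p J F) - (\<Sum>j\<in>J. (4 * \<theta>\<^sup>2 * \<beta>\<^sup>2 * p j) *\<^sub>R q j))))
    \<le> tr 1 * exp (- t)"
proof -
  define H where "H S = \<theta> *\<^sub>R (F S - bernoulli_mean p J F) - (\<Sum>j\<in>J. (4 * \<theta>\<^sup>2 * \<beta>\<^sup>2 * p j) *\<^sub>R q j)" for S
  define bad :: "'s set \<Rightarrow> real" where "bad S = of_bool (\<exists>\<phi>. state \<phi> \<and> t \<le> \<phi> (H S))" for S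
  have "selfadjoint (bernoulli_mean p J F)"
    unfolding bernoulli_mean_def by (intro selfadjoint_intros sa) auto
  then have saH: "selfadjoint (H S)" if "S \<subseteq> J" for S
    unfolding H_def using that J(3)
    by (intro selfadjoint_intros sa) (auto simp: projection_def selfadjoint_def)
  have "\<exists>c. \<forall>k>0. bernoulli_mean p J (\<lambda>S. pot k (0 + \<theta> *\<^sub>R (F S - bernoulli_mean p J F) -
      (\<Sum>j\<in>J. (4 * \<theta>\<^sup>2 * \<beta>\<^sup>2 * p j) *\<^sub>R q j))) \<le> pot k 0 + c / 2 ^ k"
    apply (rule ex_forward[OF bernoulli_mean_pot_le[where a = 0, OF J \<theta>]], assumption, assumption)
    subgoal premises c for c
    proof (intro allI impI)
      fix k :: nat
      assume "0 < k"
      from c[THEN spec, THEN mp, OF this, THEN spec[of _ 0], THEN spec[of _ F]]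
      show "bernoulli_mean p J (\<lambda>S. pot k (0 + \<theta> *\<^sub>R (F S - bernoulli_mean p J F) -
          (\<Sum>j\<in>J. (4 * \<theta>\<^sup>2 * \<beta>\<^sup>2 * p j) *\<^sub>R q j))) \<le> pot k 0 + c / 2 ^ k"
        using F selfadjoint_zero opbound_zero by blast
    qed
    done
  then obtain c where c: "bernoulli_mean p J (\<lambda>S. pot k (0 + \<theta> *\<^sub>R (F S - bernoulli_mean p J F) -
      (\<Sum>j\<in>J. (4 * \<theta>\<^sup>2 * \<beta>\<^sup>2 * p j) *\<^sub>R q j))) \<le> pot k 0 + c / 2 ^ k" if "0 < k" for k
    by blast
  have c: "bernoulli_mean p J (\<lambda>S. pot k (H S)) \<le> tr 1 + c / 2 ^ k" if "0 < k" for k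
    using c[OF that] by (simp add: H_def pot_def[of k 0])
  have "eventually (\<lambda>k. (1 + t / 2 ^ k) ^ 2 ^ k * bernoulli_mean p J bad \<le> tr 1 + c / 2 ^ k) sequentially"
    using eventually_gt_at_top[of 0]
  proof eventually_elim
    case (elim k)
    have "(1 + t / 2 ^ k) ^ 2 ^ k * bernoulli_mean p J bad
        = bernoulli_mean p J (\<lambda>S. (1 + t / 2 ^ k) ^ 2 ^ k * bad S)"
      by (simp add: bernoulli_mean_cmult)
    also have "\<dots> \<le> bernoulli_mean p J (\<lambda>S. pot k (H S))"
      using pot_nonneg[OF saH elim] t J(2)
      by (intro bernoulli_mean_mono) (auto simp: bad_def)
    finally show ?case using c[OF elim] by simp
  qed
  moreover have pow2: "filterlim (\<lambda>k. 2 ^ k :: nat) at_top sequentially"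
    by (intro filterlim_subseq strict_monoI) simp
  have "((\<lambda>k. (1 + t / 2 ^ k) ^ 2 ^ k * bernoulli_mean p J bad) \<longlongrightarrow> exp t * bernoulli_mean p J bad) sequentially"
    using filterlim_compose[OF tendsto_exp_limit_sequentially[of t] pow2]
    by (intro tendsto_mult) simp_all
  moreover have "((\<lambda>k. tr 1 + c / 2 ^ k) \<longlongrightarrow> tr 1 + 0) sequentially"
    by (intro tendsto_add tendsto_const tendsto_divide_0[OF tendsto_const] filterlim_realpow_sequentially_gt1) simp
  ultimately have "exp t * bernoulli_mean p J bad \<le> tr 1 + 0"
    by (intro tendsto_le[OF sequentially_bot]) auto
  then show ?thesis
    unfolding bad_def H_def by (simp add: exp_minus field_simps)
qed

end

section \<open>The tracial algebra of square matrices\<close>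

text \<open>
  Matrices of a variable dimension \<open>n\<close> do not form a type. Families with one matrix for every
  dimension do, and they form a unital algebra, on which the trace of the component at \<open>n\<close> is a
  tracial functional; so the results above apply for each \<open>n\<close>.
\<close>

typedef mat_family = "{A :: nat \<Rightarrow> real mat. \<forall>n. A n \<in> carrier_mat n n}"
  morphisms component Mat_family
  by (intro exI[of _ "\<lambda>n. 0\<^sub>m n n"]) simp

setup_lifting type_definition_mat_family

lemma component_carrier [simp]: "component A n \<in> carrier_mat n n"
  using component by blast

lemma component_dim [simp]: "dim_row (component A n) = n" "dim_col (component A n) = n"
  using component_carrier[of A n] by (simp_all only: carrier_matD)

lemma mat_family_eqI: "(\<And>n. component A n = component B n) \<Longrightarrow> A = B"
  by (auto simp flip: component_inject)

instantiation mat_family :: real_algebra_1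
begin

lift_definition zero_mat_family :: mat_family is "\<lambda>n. 0\<^sub>m n n" by simp
lift_definition one_mat_family :: mat_family is "\<lambda>n. 1\<^sub>m n" by simp
lift_definition plus_mat_family :: "mat_family \<Rightarrow> mat_family \<Rightarrow> mat_family" is "\<lambda>A B n. A n + B n" by simp
lift_definition minus_mat_family :: "mat_family \<Rightarrow> mat_family \<Rightarrow> mat_family" is "\<lambda>A B n. A n - B n"
  by (rule minus_carrier_mat)
lift_definition uminus_mat_family :: "mat_family \<Rightarrow> mat_family" is "\<lambda>A n. - A n" by simp
lift_definition times_mat_family :: "mat_family \<Rightarrow> mat_family \<Rightarrow> mat_family" is "\<lambda>A B n. A n * B n"
  by (meson mult_carrier_mat)
lift_definition scaleR_mat_family :: "real \<Rightarrow> mat_family \<Rightarrow> mat_family" is "\<lambda>c A n. c \<cdot>\<^sub>m A n" by simp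

lemmas component_simps = zero_mat_family.rep_eq one_mat_family.rep_eq plus_mat_family.rep_eq
  minus_mat_family.rep_eq uminus_mat_family.rep_eq times_mat_family.rep_eq scaleR_mat_family.rep_eq

instance
proof
  fix a b c :: mat_family and r s :: real
  show "a + b + c = a + (b + c)" "a + b = b + a" "0 + a = a" "- a + a = 0" "a - b = a + - b"
    "r *\<^sub>R (a + b) = r *\<^sub>R a + r *\<^sub>R b" "(r + s) *\<^sub>R a = r *\<^sub>R a + s *\<^sub>R a"
    "r *\<^sub>R s *\<^sub>R a = (r * s) *\<^sub>R a" "1 *\<^sub>R a = a"
    by (intro mat_family_eqI eq_matI; simp add: component_simps distrib_left distrib_right)+
  show "a * b * c = a * (b * c)"
    by (intro mat_family_eqI) (simp add: component_simps assoc_mult_mat[OF component_carrier component_carrier component_carrier])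
  show "(a + b) * c = a * c + b * c"
    by (intro mat_family_eqI) (simp add: component_simps add_mult_distrib_mat[OF component_carrier component_carrier component_carrier])
  show "a * (b + c) = a * b + a * c"
    by (intro mat_family_eqI) (simp add: component_simps mult_add_distrib_mat[OF component_carrier component_carrier component_carrier])
  show "r *\<^sub>R a * b = r *\<^sub>R (a * b)"
    by (intro mat_family_eqI) (simp add: component_simps mult_smult_assoc_mat[OF component_carrier component_carrier])
  show "a * r *\<^sub>R b = r *\<^sub>R (a * b)"
    by (intro mat_family_eqI) (simp add: component_simps mult_smult_distrib[OF component_carrier component_carrier])
  show "1 * a = a" "a * 1 = a"
    by (intro mat_family_eqI; simp add: component_simps)+
  show "(0::mat_family) \<noteq> 1"
  proof
    assume "(0::mat_family) = 1"
    \<comment> \<open>Dimension 1 is inspected because in dimension 0 the two matrices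
      coincide.\<close>
    then have "component 0 1 $$ (0, 0) = component 1 1 $$ (0, 0)" by simp
    then show False by (simp add: zero_mat_family.rep_eq one_mat_family.rep_eq)
  qed
qed

end

section \<open>Entries, transposes and traces of matrix families\<close>

definition entry :: "nat \<Rightarrow> mat_family \<Rightarrow> nat \<Rightarrow> nat \<Rightarrow> real" where
  "entry n A i j = component A n $$ (i, j)"

lemma entry_simps:
  assumes "i < n" "j < n"
  shows "entry n 0 i j = 0" "entry n 1 i j = of_bool (i = j)"
    "entry n (A + B) i j = entry n A i j + entry n B i j"
    "entry n (A - B) i j = entry n A i j - entry n B i j"
    "entry n (- A) i j = - entry n A i j"
    "entry n (c *\<^sub>R A) i j = c * entry n A i j"
    "entry n (A * B) i j = (\<Sum>k<n. entry n A i k * entry n B k j)"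
  using assms
  by (simp_all add: entry_def component_simps scalar_prod_def lessThan_atLeast0)

lemma mat_family_entry_eqI:
  "(\<And>n i j. i < n \<Longrightarrow> j < n \<Longrightarrow> entry n A i j = entry n B i j) \<Longrightarrow> A = B"
  unfolding entry_def by (intro mat_family_eqI eq_matI) simp_all

lemma linear_entry: "i < n \<Longrightarrow> j < n \<Longrightarrow> linear (\<lambda>A. entry n A i j)"
  by (rule linearI) (simp_all add: entry_simps)

lift_definition transpose_family :: "mat_family \<Rightarrow> mat_family" is "\<lambda>A n. transpose_mat (A n)"
  by simp

lemma entry_transpose [simp]: "i < n \<Longrightarrow> j < n \<Longrightarrow> entry n (transpose_family A) i j = entry n A j i"
  by (simp add: entry_def transpose_family.rep_eq)

definition trace_at :: "nat \<Rightarrow> mat_family \<Rightarrow> real" where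
  "trace_at n A = (\<Sum>i<n. entry n A i i)"

lemma trace_at_transpose_mult:
  "trace_at n (transpose_family A * B) = (\<Sum>i<n. \<Sum>k<n. entry n A k i * entry n B k i)"
  by (simp add: trace_at_def entry_simps)

interpretation family: tracial_algebra transpose_family "trace_at n" for n
proof (rule tracial_algebra.intro)
  fix a b :: mat_family
  show "linear transpose_family"
    by (rule linearI; intro mat_family_eqI eq_matI; simp add: component_simps transpose_family.rep_eq)
  show "transpose_family (a * b) = transpose_family b * transpose_family a"
    by (intro mat_family_eqI)
      (simp add: component_simps transpose_family.rep_eq transpose_mult[OF component_carrier component_carrier])
  show "transpose_family (transpose_family a) = a"
    by (intro mat_family_eqI) (simp add: transpose_family.rep_eq)
  show "linear (trace_at n)"
    by (rule linearI) (simp_all add: trace_at_def entry_simps sum.distrib sum_distrib_left)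
  have "trace_at n (a * b) = (\<Sum>i<n. \<Sum>k<n. entry n a i k * entry n b k i)"
    by (simp add: trace_at_def entry_simps)
  also have "\<dots> = (\<Sum>k<n. \<Sum>i<n. entry n b k i * entry n a i k)"
    by (subst sum.swap) (simp add: mult.commute)
  also have "\<dots> = trace_at n (b * a)"
    by (simp add: trace_at_def entry_simps)
  finally show "trace_at n (a * b) = trace_at n (b * a)" .
  show "trace_at n (transpose_family a) = trace_at n a"
    by (simp add: trace_at_def)
  show "0 \<le> trace_at n (transpose_family a * a)"
    by (simp add: trace_at_transpose_mult sum_nonneg)
qed

lemma trace_at_one: "trace_at n 1 = real n"
  by (simp add: trace_at_def entry_simps)

lemma nrm_family_power2: "(family.nrm n A)\<^sup>2 = (\<Sum>j<n. \<Sum>i<n. (entry n A i j)\<^sup>2)"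
  unfolding family.nrm_power2 trace_at_transpose_mult by (simp add: power2_eq_square)

text \<open>Selfadjointness and idempotence are equations between whole families, so the components
  in the other dimensions are filled with 0, where both hold.\<close>

lift_definition single_family :: "nat \<Rightarrow> (nat \<Rightarrow> nat \<Rightarrow> real) \<Rightarrow> mat_family" is
  "\<lambda>n a m. if m = n then mat n n (\<lambda>(i, j). a i j) else 0\<^sub>m m m"
  by simp

lemma entry_single:
  "i < m \<Longrightarrow> j < m \<Longrightarrow> entry m (single_family n a) i j = (if m = n then a i j else 0)"
  by (simp add: entry_def single_family.rep_eq)

lemma selfadjoint_single:
  assumes "\<And>i j. i < n \<Longrightarrow> j < n \<Longrightarrow> a i j = a j i"
  shows "family.selfadjoint (single_family n a)"
  unfolding family.selfadjoint_def
  by (intro mat_family_entry_eqI) (simp add: entry_single assms)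

lemma single_family_diff: "single_family n a - single_family n b = single_family n (\<lambda>i j. a i j - b i j)"
  by (intro mat_family_entry_eqI) (simp add: entry_single entry_simps)

definition coordinate_projection :: "nat \<Rightarrow> nat set \<Rightarrow> mat_family" where
  "coordinate_projection n P = single_family n (\<lambda>i j. of_bool (i = j \<and> i \<in> P))"

lemma entry_projection_mult:
  assumes "i < n" "j < n"
  shows "entry n (coordinate_projection n P * x) i j = of_bool (i \<in> P) * entry n x i j"
proof -
  have "entry n (coordinate_projection n P * x) i j
      = (\<Sum>k<n. of_bool (i = k \<and> i \<in> P) * entry n x k j)"
    using assms by (simp add: entry_simps entry_single coordinate_projection_def)
  also have "\<dots> = (\<Sum>k<n. if k = i then of_bool (i \<in> P) * entry n x k j else 0)"
    by (intro sum.cong) auto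
  finally show ?thesis using assms by simp
qed

lemma projection_coordinate_projection: "family.projection (coordinate_projection n P)"
proof -
  let ?Q = "coordinate_projection n P"
  have "transpose_family ?Q = ?Q"
    unfolding coordinate_projection_def
    by (rule family.selfadjointD, rule selfadjoint_single) auto
  moreover have "?Q * ?Q = ?Q"
  proof (rule mat_family_entry_eqI)
    fix m i j :: nat
    assume ij: "i < m" "j < m"
    show "entry m (?Q * ?Q) i j = entry m ?Q i j"
    proof (cases "m = n")
      case True
      with ij show ?thesis
        by (simp add: entry_projection_mult) (simp add: coordinate_projection_def entry_single)
    next
      case False
      with ij show ?thesis
        by (simp add: entry_simps coordinate_projection_def entry_single)
    qed
  qed
  ultimately show ?thesis by (simp add: family.projection_def)
qed

text \<open>The Schur test. Cauchy-Schwarz with weights \<open>sqrt (a i k)\<close> uses the row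
  sums for one factor \<open>\<beta>\<close>; by symmetry the column sums give the other, and they
  vanish outside \<open>P\<close>, which produces the projection.\<close>

lemma single_in_influences:
  assumes \<beta>: "0 \<le> \<beta>" and sym: "\<And>i j. i < n \<Longrightarrow> j < n \<Longrightarrow> d i j = d j i"
    and d: "\<And>i j. i < n \<Longrightarrow> j < n \<Longrightarrow> \<bar>d i j\<bar> \<le> a i j"
    and sum: "\<And>i. i < n \<Longrightarrow> (\<Sum>j<n. a i j) \<le> \<beta> * of_bool (i \<in> P)"
    and sym_a: "\<And>i j. i < n \<Longrightarrow> j < n \<Longrightarrow> a i j = a j i"
  shows "single_family n d \<in> family.influences n \<beta> (coordinate_projection n P)"
proof -
  have a: "0 \<le> a i j" if "i < n" "j < n" for i j
    using d[OF that] by linarith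
  have vec: "(\<Sum>i<n. (\<Sum>k<n. d i k * u k)\<^sup>2) \<le> \<beta>\<^sup>2 * (\<Sum>k<n. of_bool (k \<in> P) * (u k)\<^sup>2)"
    for u :: "nat \<Rightarrow> real"
  proof -
    have row: "(\<Sum>k<n. d i k * u k)\<^sup>2 \<le> \<beta> * (\<Sum>k<n. a i k * (u k)\<^sup>2)" if i: "i < n" for i
    proof -
      have "\<bar>\<Sum>k<n. d i k * u k\<bar> \<le> (\<Sum>k<n. sqrt (a i k) * (sqrt (a i k) * \<bar>u k\<bar>))"
        using i d a by (intro order.trans[OF sum_abs] sum_mono)
          (auto simp: abs_mult mult_right_mono simp flip: mult.assoc)
      then have "(\<Sum>k<n. d i k * u k)\<^sup>2 \<le> (\<Sum>k<n. sqrt (a i k) * (sqrt (a i k) * \<bar>u k\<bar>))\<^sup>2"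
        by (metis abs_ge_zero power2_abs power_mono)
      also have "\<dots> \<le> (\<Sum>k<n. (sqrt (a i k))\<^sup>2) * (\<Sum>k<n. (sqrt (a i k) * \<bar>u k\<bar>)\<^sup>2)"
        by (rule Cauchy_Schwarz_ineq_sum)
      also have "\<dots> = (\<Sum>k<n. a i k) * (\<Sum>k<n. a i k * (u k)\<^sup>2)"
        using i a by (simp add: power_mult_distrib)
      also have "\<dots> \<le> \<beta> * (\<Sum>k<n. a i k * (u k)\<^sup>2)"
        using i a order.trans[OF sum[OF i], of \<beta>] \<beta> by (intro mult_right_mono sum_nonneg) simp_all
      finally show ?thesis .
    qed
    have "(\<Sum>i<n. (\<Sum>k<n. d i k * u k)\<^sup>2) \<le> (\<Sum>i<n. \<beta> * (\<Sum>k<n. a i k * (u k)\<^sup>2))"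
      using row by (intro sum_mono) simp
    also have "\<dots> = \<beta> * (\<Sum>k<n. (\<Sum>i<n. a k i) * (u k)\<^sup>2)"
    proof -
      have "(\<Sum>i<n. \<Sum>k<n. a i k * (u k)\<^sup>2) = (\<Sum>k<n. \<Sum>i<n. a k i * (u k)\<^sup>2)"
        by (subst sum.swap) (intro sum.cong refl, simp add: sym_a)
      then show ?thesis
        by (simp only: sum_distrib_left[symmetric] sum_distrib_right)
    qed
    also have "\<dots> \<le> \<beta> * (\<Sum>k<n. (\<beta> * of_bool (k \<in> P)) * (u k)\<^sup>2)"
      using sum \<beta> by (intro mult_left_mono sum_mono mult_right_mono) simp_all
    also have "\<dots> = \<beta>\<^sup>2 * (\<Sum>k<n. of_bool (k \<in> P) * (u k)\<^sup>2)"
      by (simp add: sum_distrib_left power2_eq_square mult_ac)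
    finally show ?thesis .
  qed
  have "family.nrm n (single_family n d * x) \<le> \<beta> * family.nrm n (coordinate_projection n P * x)" for x
  proof (rule power2_le_imp_le)
    \<comment> \<open>The squared seminorm is a sum over the columns of \<open>x\<close>, so
      \<open>vec\<close> is applied to each column.\<close>
    have "(family.nrm n (single_family n d * x))\<^sup>2 = (\<Sum>j<n. \<Sum>i<n. (\<Sum>k<n. d i k * entry n x k j)\<^sup>2)"
      by (simp add: nrm_family_power2 entry_simps entry_single)
    also have "\<dots> \<le> (\<Sum>j<n. \<beta>\<^sup>2 * (\<Sum>k<n. of_bool (k \<in> P) * (entry n x k j)\<^sup>2))"
      by (intro sum_mono vec)
    also have "\<dots> = (\<beta> * family.nrm n (coordinate_projection n P * x))\<^sup>2"
    proof -
      have "(of_bool b * y)\<^sup>2 = of_bool b * y\<^sup>2" for b and y :: real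
        by (cases b) simp_all
      then show ?thesis
        by (simp only: power_mult_distrib[of \<beta>] nrm_family_power2 sum_distrib_left)
          (simp add: entry_projection_mult)
    qed
    finally show "(family.nrm n (single_family n d * x))\<^sup>2 \<le>
      (\<beta> * family.nrm n (coordinate_projection n P * x))\<^sup>2" .
  qed (use \<beta> in simp)
  moreover have "family.selfadjoint (single_family n d)"
    using sym by (rule selfadjoint_single)
  ultimately show ?thesis
    by (simp add: family.influences_def)
qed

section \<open>Unit vectors as states\<close>

definition quadratic_form :: "nat \<Rightarrow> (nat \<Rightarrow> nat \<Rightarrow> real) \<Rightarrow> (nat \<Rightarrow> real) \<Rightarrow> real" where
  "quadratic_form n a v = (\<Sum>i<n. \<Sum>j<n. v i * a i j * v j)"

text \<open>On \<open>a^T a\<close> the form is the squared length of \<open>a v\<close>, which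
  Cauchy-Schwarz bounds by the squared Hilbert-Schmidt norm of \<open>a\<close>.\<close>

lemma state_quadratic_form:
  assumes v: "(\<Sum>i<n. (v i)\<^sup>2) = 1"
  shows "family.state n (\<lambda>A. quadratic_form n (entry n A) v)"
  unfolding family.state_def
proof (intro conjI allI)
  show "linear (\<lambda>A. quadratic_form n (entry n A) v)"
    by (rule linearI)
      (simp_all add: quadratic_form_def entry_simps algebra_simps sum.distrib sum_distrib_left)
  have "quadratic_form n (entry n 1) v = (\<Sum>i<n. \<Sum>j<n. if j = i then v i * v i else 0)"
    unfolding quadratic_form_def by (intro sum.cong) (auto simp: entry_simps)
  then show "quadratic_form n (entry n 1) v = 1"
    using v by (simp add: power2_eq_square)
  fix a :: mat_family
  have eq: "quadratic_form n (entry n (transpose_family a * a)) v = (\<Sum>k<n. (\<Sum>j<n. entry n a k j * v j)\<^sup>2)"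
  proof -
    have "quadratic_form n (entry n (transpose_family a * a)) v
        = (\<Sum>i<n. \<Sum>j<n. \<Sum>k<n. (entry n a k i * v i) * (entry n a k j * v j))"
      by (simp add: quadratic_form_def entry_simps sum_distrib_left sum_distrib_right mult_ac)
    also have "\<dots> = (\<Sum>i<n. \<Sum>k<n. \<Sum>j<n. (entry n a k i * v i) * (entry n a k j * v j))"
      by (intro sum.cong refl sum.swap)
    also have "\<dots> = (\<Sum>k<n. \<Sum>i<n. \<Sum>j<n. (entry n a k i * v i) * (entry n a k j * v j))"
      by (rule sum.swap)
    finally show ?thesis
      by (simp add: power2_eq_square sum_product)
  qed
  show "0 \<le> quadratic_form n (entry n (transpose_family a * a)) v"
    unfolding eq by (intro sum_nonneg) simp
  have "(\<Sum>k<n. (\<Sum>j<n. entry n a k j * v j)\<^sup>2) \<le> (\<Sum>k<n. (\<Sum>j<n. (entry n a k j)\<^sup>2) * (\<Sum>j<n. (v j)\<^sup>2))"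
    by (intro sum_mono Cauchy_Schwarz_ineq_sum)
  also have "\<dots> = trace_at n (transpose_family a * a)"
    unfolding v trace_at_transpose_mult by (subst sum.swap) (simp add: power2_eq_square)
  finally show "quadratic_form n (entry n (transpose_family a * a)) v \<le> trace_at n (transpose_family a * a)"
    by (simp add: eq)
qed

text \<open>The compensator is diagonal with entries at most
  \<open>4 \<theta>^2 \<beta>^2 D\<close>. A unit vector whose form reaches \<open>r\<close> is
  therefore a state on which the compensated matrix is at least \<open>t\<close>, by the hypothesis
  relating \<open>t\<close> and \<open>r\<close>.\<close>

lemma quadratic_form_tail:
  fixes p :: "'s \<Rightarrow> real" and a :: "'s \<Rightarrow> nat \<Rightarrow> nat \<Rightarrow> real" and P :: "'s \<Rightarrow> nat set"
    and U :: "'s set \<Rightarrow> nat \<Rightarrow> nat \<Rightarrow> real" and \<theta> \<beta> D t r :: real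
  assumes J: "finite J" "\<And>s. s \<in> J \<Longrightarrow> p s \<in> {0..1}"
    and \<theta>: "0 < \<theta>" "0 \<le> \<beta>" "\<theta> * \<beta> \<le> 1 / 4" and t: "0 \<le> t"
    and sym_a: "\<And>s i j. s \<in> J \<Longrightarrow> i < n \<Longrightarrow> j < n \<Longrightarrow> a s i j = a s j i"
    and sym_U: "\<And>S i j. S \<subseteq> J \<Longrightarrow> i < n \<Longrightarrow> j < n \<Longrightarrow> U S i j = U S j i"
    and U: "\<And>s S i j. s \<in> J \<Longrightarrow> S \<subseteq> J - {s} \<Longrightarrow> i < n \<Longrightarrow> j < n \<Longrightarrow>
      \<bar>U (insert s S) i j - U S i j\<bar> \<le> a s i j"
    and P: "\<And>s i. s \<in> J \<Longrightarrow> i < n \<Longrightarrow> (\<Sum>j<n. a s i j) \<le> \<beta> * of_bool (i \<in> P s)"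
    and D: "\<And>i. i < n \<Longrightarrow> (\<Sum>s\<in>J. p s * of_bool (i \<in> P s)) \<le> D"
    and r: "t + 4 * \<theta>\<^sup>2 * \<beta>\<^sup>2 * D \<le> \<theta> * r"
  shows "bernoulli_mean p J (\<lambda>S. of_bool (\<exists>v. (\<Sum>i<n. (v i)\<^sup>2) = 1 \<and>
      r \<le> quadratic_form n (\<lambda>i j. U S i j - bernoulli_mean p J (\<lambda>S. U S i j)) v)) \<le> real n * exp (- t)"
proof -
  define F where "F S = single_family n (U S)" for S
  define q where "q s = coordinate_projection n (P s)" for s
  let ?C = "\<Sum>s\<in>J. (4 * \<theta>\<^sup>2 * \<beta>\<^sup>2 * p s) *\<^sub>R q s"
  have "bernoulli_mean p J (\<lambda>S. of_bool (\<exists>\<phi>. family.state n \<phi> \<and>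
      t \<le> \<phi> (\<theta> *\<^sub>R (F S - bernoulli_mean p J F) - ?C))) \<le> trace_at n 1 * exp (- t)"
    using J \<theta> t
  proof (intro family.bernoulli_matrix_tail)
    fix s S assume s: "s \<in> J" "S \<subseteq> J - {s}"
    then have S: "S \<subseteq> J" "insert s S \<subseteq> J" by auto
    show "F (insert s S) - F S \<in> family.influences n \<beta> (q s)"
      unfolding F_def q_def single_family_diff
      using s \<theta>(2) sym_U[OF S(1)] sym_U[OF S(2)] sym_a P U
      by (intro single_in_influences[where a = "a s"]) simp_all
  qed (auto simp: F_def q_def projection_coordinate_projection intro!: selfadjoint_single sym_U)
  moreover have "\<exists>\<phi>. family.state n \<phi> \<and> t \<le> \<phi> (\<theta> *\<^sub>R (F S - bernoulli_mean p J F) - ?C)"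
    if v: "(\<Sum>i<n. (v i)\<^sup>2) = 1"
      and rv: "r \<le> quadratic_form n (\<lambda>i j. U S i j - bernoulli_mean p J (\<lambda>S. U S i j)) v" for v S
  proof (intro exI conjI)
    let ?\<phi> = "\<lambda>A. quadratic_form n (entry n A) v"
    show state: "family.state n ?\<phi>"
      by (rule state_quadratic_form[OF v])
    then have lin: "linear ?\<phi>" by (simp add: family.state_def)
    have phi_q: "?\<phi> (q s) = (\<Sum>i<n. of_bool (i \<in> P s) * (v i)\<^sup>2)" for s
    proof -
      have "?\<phi> (q s) = (\<Sum>i<n. \<Sum>j<n. if j = i then of_bool (i \<in> P s) * (v i)\<^sup>2 else 0)"
        unfolding quadratic_form_def q_def coordinate_projection_def
        by (intro sum.cong) (auto simp: power2_eq_square entry_single)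
      then show ?thesis by simp
    qed
    have "?\<phi> ?C = (\<Sum>s\<in>J. (4 * \<theta>\<^sup>2 * \<beta>\<^sup>2 * p s) * (\<Sum>i<n. of_bool (i \<in> P s) * (v i)\<^sup>2))"
      by (simp add: linear_sum[OF lin] linear_scale[OF lin] phi_q)
    also have "\<dots> = 4 * \<theta>\<^sup>2 * \<beta>\<^sup>2 * (\<Sum>i<n. (\<Sum>s\<in>J. p s * of_bool (i \<in> P s)) * (v i)\<^sup>2)"
      unfolding sum_distrib_left sum_distrib_right by (subst sum.swap) (simp add: mult_ac)
    also have "\<dots> \<le> 4 * \<theta>\<^sup>2 * \<beta>\<^sup>2 * (\<Sum>i<n. D * (v i)\<^sup>2)"
      using D by (intro mult_left_mono sum_mono mult_right_mono) simp_all
    also have "\<dots> = 4 * \<theta>\<^sup>2 * \<beta>\<^sup>2 * D"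
      by (simp add: v flip: sum_distrib_left)
    finally have phi_C: "?\<phi> ?C \<le> 4 * \<theta>\<^sup>2 * \<beta>\<^sup>2 * D" .
    have "quadratic_form n (\<lambda>i j. U S i j - bernoulli_mean p J (\<lambda>S. U S i j)) v = ?\<phi> (F S - bernoulli_mean p J F)"
      unfolding quadratic_form_def
      by (intro sum.cong) (simp_all add: entry_simps entry_single F_def bernoulli_mean_linear[OF linear_entry])
    then have "\<theta> * r \<le> ?\<phi> (\<theta> *\<^sub>R (F S - bernoulli_mean p J F))"
      using rv \<theta> by (simp add: linear_scale[OF lin])
    with phi_C r show "t \<le> ?\<phi> (\<theta> *\<^sub>R (F S - bernoulli_mean p J F) - ?C)"
      by (simp add: linear_diff[OF lin])
  qed
  then have "bernoulli_mean p J (\<lambda>S. of_bool (\<exists>v. (\<Sum>i<n. (v i)\<^sup>2) = 1 \<and>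
      r \<le> quadratic_form n (\<lambda>i j. U S i j - bernoulli_mean p J (\<lambda>S. U S i j)) v))
    \<le> (bernoulli_mean p J (\<lambda>S. of_bool (\<exists>\<phi>. family.state n \<phi> \<and>
      t \<le> \<phi> (\<theta> *\<^sub>R (F S - bernoulli_mean p J F) - ?C))) :: real)"
    using J(2) by (intro bernoulli_mean_mono) auto
  ultimately show ?thesis
    by (simp add: trace_at_one)
qed

section \<open>From quadratic forms to the spectral norm\<close>

definition bilinear_form :: "nat \<Rightarrow> (nat \<Rightarrow> nat \<Rightarrow> real) \<Rightarrow> (nat \<Rightarrow> real) \<Rightarrow> (nat \<Rightarrow> real) \<Rightarrow> real" where
  "bilinear_form n a u v = (\<Sum>i<n. \<Sum>j<n. u i * a i j * v j)"

text \<open>Polarization and the parallelogram law, after scaling the bound on unit vectors to all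
  vectors.\<close>

lemma bilinear_form_le:
  assumes sym: "\<And>i j. i < n \<Longrightarrow> j < n \<Longrightarrow> a i j = a j i"
    and bound: "\<And>v. (\<Sum>i<n. (v i)\<^sup>2) = 1 \<Longrightarrow> \<bar>quadratic_form n a v\<bar> \<le> r"
    and "0 \<le> r"
  shows "bilinear_form n a u v \<le> r * ((\<Sum>i<n. (u i)\<^sup>2) + (\<Sum>i<n. (v i)\<^sup>2)) / 2"
proof -
  have scaled: "\<bar>quadratic_form n a w\<bar> \<le> r * (\<Sum>i<n. (w i)\<^sup>2)" for w
  proof (cases "(\<Sum>i<n. (w i)\<^sup>2) = 0")
    case True
    then have "\<forall>i\<in>{..<n}. (w i)\<^sup>2 = 0"
      by (subst (asm) sum_nonneg_eq_0_iff) simp_all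
    then show ?thesis
      using True by (simp add: quadratic_form_def)
  next
    case False
    define m where "m = sqrt (\<Sum>i<n. (w i)\<^sup>2)"
    have m2: "m\<^sup>2 = (\<Sum>i<n. (w i)\<^sup>2)"
      by (simp add: m_def sum_nonneg)
    with False have m0: "m \<noteq> 0" by auto
    have "(\<Sum>i<n. (w i / m)\<^sup>2) = 1"
      using m0 unfolding power_divide sum_divide_distrib[symmetric] m2[symmetric] by simp
    then have "\<bar>quadratic_form n a (\<lambda>i. w i / m)\<bar> \<le> r"
      by (rule bound)
    moreover have "quadratic_form n a (\<lambda>i. w i / m) = quadratic_form n a w / m\<^sup>2"
      by (simp add: quadratic_form_def power2_eq_square sum_divide_distrib)
    ultimately have "\<bar>quadratic_form n a w\<bar> / m\<^sup>2 \<le> r"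
      by simp
    then show ?thesis
      using m0 unfolding m2[symmetric] by (simp add: divide_le_eq)
  qed
  have swap: "bilinear_form n a v u = bilinear_form n a u v"
    unfolding bilinear_form_def
    by (subst sum.swap) (intro sum.cong refl, simp add: sym mult_ac)
  have "4 * bilinear_form n a u v = quadratic_form n a (\<lambda>i. u i + v i) - quadratic_form n a (\<lambda>i. u i - v i)"
    using swap unfolding quadratic_form_def bilinear_form_def
    by (simp add: algebra_simps sum.distrib sum_subtractf)
  also have "\<dots> \<le> r * (\<Sum>i<n. (u i + v i)\<^sup>2) + r * (\<Sum>i<n. (u i - v i)\<^sup>2)"
    using scaled[of "\<lambda>i. u i + v i"] scaled[of "\<lambda>i. u i - v i"] by linarith
  also have "\<dots> = 2 * r * ((\<Sum>i<n. (u i)\<^sup>2) + (\<Sum>i<n. (v i)\<^sup>2))"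
    by (simp add: power2_sum power2_diff sum.distrib sum_subtractf algebra_simps)
  finally show ?thesis by simp
qed

text \<open>Duality: the length \<open>l\<close> of \<open>A v\<close> is the bilinear form of
  \<open>A\<close> at \<open>A v / l\<close> and \<open>v\<close>, both of length at most 1.\<close>

lemma spectral_norm_le:
  assumes A: "A \<in> carrier_mat n n" and sym: "\<And>i j. i < n \<Longrightarrow> j < n \<Longrightarrow> A $$ (i, j) = A $$ (j, i)"
    and bound: "\<And>v. (\<Sum>i<n. (v i)\<^sup>2) = 1 \<Longrightarrow> \<bar>quadratic_form n (\<lambda>i j. A $$ (i, j)) v\<bar> \<le> r"
    and r: "0 \<le> r"
  shows "spectral_norm A \<le> r"
  unfolding spectral_norm_def
proof (rule cSUP_least)
  have "euclidean_norm (0\<^sub>v n) \<le> 1"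
    by (simp add: euclidean_norm_def L2_set_def)
  then show "{v \<in> carrier_vec (dim_col A). euclidean_norm v \<le> 1} \<noteq> {}"
    using A by (auto intro!: exI[of _ "0\<^sub>v n"])
  fix v assume "v \<in> {v \<in> carrier_vec (dim_col A). euclidean_norm v \<le> 1}"
  then have v: "dim_vec v = n" "euclidean_norm v \<le> 1" using A by auto
  define w where "w i = (\<Sum>j<n. A $$ (i, j) * v $ j)" for i
  define l where "l = euclidean_norm (A *\<^sub>v v)"
  have l: "0 \<le> l" "l\<^sup>2 = (\<Sum>i<n. (w i)\<^sup>2)"
  proof -
    have "l = sqrt (\<Sum>i<n. (w i)\<^sup>2)"
      using A v by (simp add: l_def w_def euclidean_norm_def L2_set_def mult_mat_vec_def
          scalar_prod_def lessThan_atLeast0)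
    then show "0 \<le> l" "l\<^sup>2 = (\<Sum>i<n. (w i)\<^sup>2)"
      by (simp_all add: sum_nonneg)
  qed
  have "0 \<le> euclidean_norm v" by (simp add: euclidean_norm_def L2_set_nonneg)
  then have "(euclidean_norm v)\<^sup>2 \<le> 1" using v(2) by (simp add: power_le_one)
  then have v1: "(\<Sum>i<n. (v $ i)\<^sup>2) \<le> 1"
    using v(1) by (simp add: euclidean_norm_def L2_set_def sum_nonneg)
  show "euclidean_norm (A *\<^sub>v v) \<le> r"
  proof (cases "l = 0")
    case True
    then show ?thesis using r by (simp add: l_def)
  next
    case False
    have "l = bilinear_form n (\<lambda>i j. A $$ (i, j)) (\<lambda>i. w i / l) (\<lambda>i. v $ i)"
    proof -
      have "bilinear_form n (\<lambda>i j. A $$ (i, j)) (\<lambda>i. w i / l) (\<lambda>i. v $ i) = (\<Sum>i<n. w i / l * w i)"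
        by (simp add: bilinear_form_def w_def[of _] sum_distrib_left mult.assoc)
      also have "\<dots> = l\<^sup>2 / l"
        unfolding l(2) by (simp add: power2_eq_square sum_divide_distrib)
      finally show ?thesis using False by (simp add: power2_eq_square)
    qed
    also have "\<dots> \<le> r * ((\<Sum>i<n. (w i / l)\<^sup>2) + (\<Sum>i<n. (v $ i)\<^sup>2)) / 2"
      using sym bound r by (rule bilinear_form_le)
    also have "(\<Sum>i<n. (w i / l)\<^sup>2) = 1"
      using False unfolding power_divide sum_divide_distrib[symmetric] l(2)[symmetric] by simp
    also have "r * (1 + (\<Sum>i<n. (v $ i)\<^sup>2)) / 2 \<le> r * (1 + 1) / 2"
      using v1 r by (intro divide_right_mono mult_left_mono) simp_all
    finally show ?thesis by (simp add: l_def)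
  qed
qed

text \<open>A large norm forces a large quadratic form of one of the two signs. The one-sided bound
  for \<open>U\<close> and for \<open>- U\<close> then gives the factor 2.\<close>

lemma spectral_norm_tail:
  fixes p :: "'s \<Rightarrow> real" and a :: "'s \<Rightarrow> nat \<Rightarrow> nat \<Rightarrow> real" and P :: "'s \<Rightarrow> nat set"
    and U :: "'s set \<Rightarrow> nat \<Rightarrow> nat \<Rightarrow> real" and \<theta> \<beta> D t r :: real
  assumes J: "finite J" "\<And>s. s \<in> J \<Longrightarrow> p s \<in> {0..1}"
    and \<theta>: "0 < \<theta>" "0 \<le> \<beta>" "\<theta> * \<beta> \<le> 1 / 4" and t: "0 \<le> t"
    and sym_a: "\<And>s i j. s \<in> J \<Longrightarrow> i < n \<Longrightarrow> j < n \<Longrightarrow> a s i j = a s j i"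
    and sym_U: "\<And>S i j. S \<subseteq> J \<Longrightarrow> i < n \<Longrightarrow> j < n \<Longrightarrow> U S i j = U S j i"
    and U: "\<And>s S i j. s \<in> J \<Longrightarrow> S \<subseteq> J - {s} \<Longrightarrow> i < n \<Longrightarrow> j < n \<Longrightarrow>
      \<bar>U (insert s S) i j - U S i j\<bar> \<le> a s i j"
    and P: "\<And>s i. s \<in> J \<Longrightarrow> i < n \<Longrightarrow> (\<Sum>j<n. a s i j) \<le> \<beta> * of_bool (i \<in> P s)"
    and D: "\<And>i. i < n \<Longrightarrow> (\<Sum>s\<in>J. p s * of_bool (i \<in> P s)) \<le> D"
    and r: "0 \<le> r" "t + 4 * \<theta>\<^sup>2 * \<beta>\<^sup>2 * D \<le> \<theta> * r"
  shows "bernoulli_mean p J (\<lambda>S. of_bool (spectral_norm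
      (mat n n (\<lambda>(i, j). U S i j - bernoulli_mean p J (\<lambda>S. U S i j))) \<le> r)) \<ge> 1 - 2 * real n * exp (- t)"
proof -
  define A where "A S = mat n n (\<lambda>(i, j). U S i j - bernoulli_mean p J (\<lambda>S. U S i j))" for S
  define up :: "'s set \<Rightarrow> real" where "up S = of_bool (\<exists>v. (\<Sum>i<n. (v i)\<^sup>2) = 1 \<and>
      r \<le> quadratic_form n (\<lambda>i j. U S i j - bernoulli_mean p J (\<lambda>S. U S i j)) v)" for S
  define lo :: "'s set \<Rightarrow> real" where "lo S = of_bool (\<exists>v. (\<Sum>i<n. (v i)\<^sup>2) = 1 \<and>
      r \<le> quadratic_form n (\<lambda>i j. - U S i j - bernoulli_mean p J (\<lambda>S. - U S i j)) v)" for S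
  have "bernoulli_mean p J up \<le> real n * exp (- t)"
    unfolding up_def by (rule quadratic_form_tail[OF J \<theta> t sym_a sym_U U P D r(2)])
  moreover have "bernoulli_mean p J lo \<le> real n * exp (- t)"
    unfolding lo_def
    by (rule quadratic_form_tail[where U = "\<lambda>S i j. - U S i j", OF J \<theta> t sym_a _ _ P D r(2)])
      (use sym_U U in \<open>auto simp: abs_minus_commute\<close>)
  moreover have "bernoulli_mean p J (\<lambda>S. 1 - (up S + lo S)) \<le>
      bernoulli_mean p J (\<lambda>S. of_bool (spectral_norm (A S) \<le> r))"
  proof (rule bernoulli_mean_mono[OF J(2)])
    fix S assume S: "S \<subseteq> J"
    have sym_mean: "bernoulli_mean p J (\<lambda>S. U S i j) = bernoulli_mean p J (\<lambda>S. U S j i)"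
      if "i < n" "j < n" for i j
      using sym_U that by (intro bernoulli_mean_cong) auto
    show "1 - (up S + lo S) \<le> of_bool (spectral_norm (A S) \<le> r)"
    proof (cases "spectral_norm (A S) \<le> r")
      case False
      have "\<not> (\<forall>v. (\<Sum>i<n. (v i)\<^sup>2) = 1 \<longrightarrow> \<bar>quadratic_form n (\<lambda>i j. A S $$ (i, j)) v\<bar> \<le> r)"
      proof
        assume "\<forall>v. (\<Sum>i<n. (v i)\<^sup>2) = 1 \<longrightarrow> \<bar>quadratic_form n (\<lambda>i j. A S $$ (i, j)) v\<bar> \<le> r"
        then have "spectral_norm (A S) \<le> r"
          using sym_U[OF S] sym_mean r(1)
          by (intro spectral_norm_le[of _ n]) (auto simp: A_def)
        with False show False ..
      qed
      then obtain v where v: "(\<Sum>i<n. (v i)\<^sup>2) = 1" "r < \<bar>quadratic_form n (\<lambda>i j. A S $$ (i, j)) v\<bar>"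
        by (auto simp: not_le)
      have q1: "quadratic_form n (\<lambda>i j. A S $$ (i, j)) v =
          quadratic_form n (\<lambda>i j. U S i j - bernoulli_mean p J (\<lambda>S. U S i j)) v"
        unfolding quadratic_form_def by (intro sum.cong) (auto simp: A_def)
      have q2: "- quadratic_form n (\<lambda>i j. A S $$ (i, j)) v =
          quadratic_form n (\<lambda>i j. - U S i j - bernoulli_mean p J (\<lambda>S. - U S i j)) v"
        unfolding quadratic_form_def sum_negf[symmetric]
        by (intro sum.cong) (auto simp: A_def bernoulli_mean_minus algebra_simps)
      from v(2) consider "r \<le> quadratic_form n (\<lambda>i j. A S $$ (i, j)) v"
        | "r \<le> - quadratic_form n (\<lambda>i j. A S $$ (i, j)) v" by linarith
      then have "up S = 1 \<or> lo S = 1"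
      proof cases
        case 1
        then show ?thesis using v(1) unfolding q1 up_def by auto
      next
        case 2
        then show ?thesis using v(1) unfolding q2 lo_def by auto
      qed
      moreover have "0 \<le> up S" "0 \<le> lo S" by (simp_all add: up_def lo_def)
      ultimately show ?thesis by auto
    qed (simp add: up_def lo_def)
  qed
  moreover have "bernoulli_mean p J (\<lambda>S. 1 - (up S + lo S)) = 1 - (bernoulli_mean p J up + bernoulli_mean p J lo)"
    using J(1) by (simp add: bernoulli_mean_diff bernoulli_mean_add bernoulli_mean_const)
  ultimately show ?thesis
    unfolding A_def by simp
qed

section \<open>The law of the set of formed subgraphs\<close>

lemma (in prob_space) formed_set_law:
  fixes x :: "'s \<Rightarrow> 'a \<Rightarrow> bool" and p :: "'s \<Rightarrow> real"
  assumes J: "finite J" and p: "\<And>s. s \<in> J \<Longrightarrow> p s \<in> {0..1}"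
    and indep: "indep_vars (\<lambda>_. count_space UNIV) x J"
    and distr: "\<And>s. s \<in> J \<Longrightarrow> distr M (count_space UNIV) (x s) = measure_pmf (bernoulli_pmf (p s))"
    and S: "S \<subseteq> J"
  shows "{\<omega> \<in> space M. {s \<in> J. x s \<omega>} = S} \<in> events"
    "prob {\<omega> \<in> space M. {s \<in> J. x s \<omega>} = S} = bernoulli_weight p J S"
proof -
  have meas: "x s \<in> measurable M (count_space UNIV)" if "s \<in> J" for s
    using indep that by (simp add: indep_vars_def)
  have single: "prob (x s -` {b} \<inter> space M) = (if b then p s else 1 - p s)" if "s \<in> J" for s b
  proof -
    have "prob (x s -` {b} \<inter> space M) = measure (distr M (count_space UNIV) (x s)) {b}"
      using meas[OF that] by (simp add: measure_distr)
    also have "\<dots> = pmf (bernoulli_pmf (p s)) b"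
      by (simp add: distr[OF that] pmf.rep_eq)
    finally show ?thesis using p[OF that] by (cases b) simp_all
  qed
  have "{\<omega> \<in> space M. {s \<in> J. x s \<omega>} = S} \<in> events \<and>
    prob {\<omega> \<in> space M. {s \<in> J. x s \<omega>} = S} = bernoulli_weight p J S"
  proof (cases "J = {}")
    case True
    then show ?thesis using S by (auto simp: bernoulli_weight_def prob_space)
  next
    case False
    \<comment> \<open>Over an empty \<open>J\<close> the intersection would be \<open>UNIV\<close>
      rather than \<open>space M\<close>, hence the case distinction.\<close>
    have eq: "{\<omega> \<in> space M. {s \<in> J. x s \<omega>} = S} = (\<Inter>s\<in>J. x s -` {s \<in> S} \<inter> space M)"
      using False S by auto
    have "prob (\<Inter>s\<in>J. x s -` {s \<in> S} \<inter> space M) = (\<Prod>s\<in>J. prob (x s -` {s \<in> S} \<inter> space M))"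
      using indep False J by (intro indep_varsD) auto
    also have "\<dots> = (\<Prod>s\<in>J. if s \<in> S then p s else 1 - p s)"
      by (intro prod.cong) (simp_all add: single)
    also have "\<dots> = (\<Prod>s\<in>J \<inter> {s. s \<in> S}. p s) * (\<Prod>s\<in>J \<inter> - {s. s \<in> S}. 1 - p s)"
      using J by (rule prod.If_cases)
    also have "\<dots> = bernoulli_weight p J S"
      using S by (simp add: bernoulli_weight_def Int_absorb1 Diff_eq)
    moreover have "x s -` {s \<in> S} \<inter> space M \<in> events" if "s \<in> J" for s
      using measurable_sets[OF meas[OF that], of "{s \<in> S}"] by simp
    ultimately show ?thesis
      unfolding eq using J False by (simp add: sets.finite_INT del: INT_simps)
  qed
  then show "{\<omega> \<in> space M. {s \<in> J. x s \<omega>} = S} \<in> events"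
    "prob {\<omega> \<in> space M. {s \<in> J. x s \<omega>} = S} = bernoulli_weight p J S" by auto
qed

lemma (in prob_space) expectation_formed_set:
  fixes x :: "'s \<Rightarrow> 'a \<Rightarrow> bool" and p :: "'s \<Rightarrow> real" and f :: "'s set \<Rightarrow> real"
  assumes J: "finite J" and p: "\<And>s. s \<in> J \<Longrightarrow> p s \<in> {0..1}"
    and indep: "indep_vars (\<lambda>_. count_space UNIV) x J"
    and distr: "\<And>s. s \<in> J \<Longrightarrow> distr M (count_space UNIV) (x s) = measure_pmf (bernoulli_pmf (p s))"
  shows "expectation (\<lambda>\<omega>. f {s \<in> J. x s \<omega>}) = bernoulli_mean p J f"
proof -
  note law = formed_set_law[OF J p indep distr]
  define E where "E S = {\<omega> \<in> space M. {s \<in> J. x s \<omega>} = S}" for S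
  have "expectation (\<lambda>\<omega>. f {s \<in> J. x s \<omega>}) = expectation (\<lambda>\<omega>. \<Sum>S\<in>Pow J. f S * indicator (E S) \<omega>)"
  proof (rule Bochner_Integration.integral_cong)
    fix \<omega> assume \<omega>: "\<omega> \<in> space M"
    have "(\<Sum>S\<in>Pow J. f S * indicator (E S) \<omega>) = (\<Sum>S\<in>Pow J. if S = {s \<in> J. x s \<omega>} then f S else 0)"
      using \<omega> by (intro sum.cong) (auto simp: E_def indicator_def)
    also have "\<dots> = f {s \<in> J. x s \<omega>}"
      using J by (subst sum.delta) auto
    finally show "f {s \<in> J. x s \<omega>} = (\<Sum>S\<in>Pow J. f S * indicator (E S) \<omega>)" by simp
  qed simp
  also have "\<dots> = (\<Sum>S\<in>Pow J. expectation (\<lambda>\<omega>. f S * indicator (E S) \<omega>))"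
    using law(1) by (intro Bochner_Integration.integral_sum integrable_mult_right)
      (auto simp: E_def less_top[symmetric] intro!: integrable_real_indicator)
  also have "\<dots> = (\<Sum>S\<in>Pow J. f S * prob (E S))"
    using law(1) by (intro sum.cong) (auto simp: E_def)
  also have "\<dots> = bernoulli_mean p J f"
    unfolding bernoulli_mean_def using law(2) by (intro sum.cong) (auto simp: E_def)
  finally show ?thesis .
qed

text \<open>Measurability is automatic for any \<open>Q\<close>, since the event is a finite union
  of atoms. In particular, the measurability of \<open>spectral_norm\<close> never has to be
  shown.\<close>

lemma (in prob_space) prob_formed_set:
  fixes x :: "'s \<Rightarrow> 'a \<Rightarrow> bool" and p :: "'s \<Rightarrow> real" and Q :: "'s set \<Rightarrow> bool"
  assumes J: "finite J" and p: "\<And>s. s \<in> J \<Longrightarrow> p s \<in> {0..1}"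
    and indep: "indep_vars (\<lambda>_. count_space UNIV) x J"
    and distr: "\<And>s. s \<in> J \<Longrightarrow> distr M (count_space UNIV) (x s) = measure_pmf (bernoulli_pmf (p s))"
  shows "prob {\<omega> \<in> space M. Q {s \<in> J. x s \<omega>}} = bernoulli_mean p J (\<lambda>S. of_bool (Q S))"
proof -
  have "{\<omega> \<in> space M. Q {s \<in> J. x s \<omega>}} = (\<Union>S\<in>{S \<in> Pow J. Q S}. {\<omega> \<in> space M. {s \<in> J. x s \<omega>} = S})"
    by auto
  also have "\<dots> \<in> events"
    using J formed_set_law(1)[OF J p indep distr] by (intro sets.finite_UN) auto
  finally have "prob {\<omega> \<in> space M. Q {s \<in> J. x s \<omega>}}
      = expectation (indicator {\<omega> \<in> space M. Q {s \<in> J. x s \<omega>}})"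
    by simp
  also have "\<dots> = expectation (\<lambda>\<omega>. of_bool (Q {s \<in> J. x s \<omega>}))"
    by (intro Bochner_Integration.integral_cong) (auto simp: indicator_def)
  also have "\<dots> = bernoulli_mean p J (\<lambda>S. of_bool (Q S))"
    by (rule expectation_formed_set[OF J p indep distr])
  finally show ?thesis .
qed

section \<open>Subgraph generated models\<close>

lemma finite_node_lists: "finite (node_lists n m)"
proof (rule finite_subset)
  show "node_lists n m \<subseteq> {L. set L \<subseteq> {..<n} \<and> length L = m}"
    by (auto simp: node_lists_def)
qed (rule finite_lists_length_eq, simp)

lemma finite_subgraph_slots: "finite T \<Longrightarrow> finite (subgraph_slots n T g)"
  by (simp add: subgraph_slots_def finite_node_lists)

section \<open>Copies of the types as matrices with bounded row sums\<close>

definition copy_entry :: "('t \<Rightarrow> nat pair_pre_digraph) \<Rightarrow> 't \<times> nat list \<Rightarrow> nat \<Rightarrow> nat \<Rightarrow> real" where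
  "copy_entry g s i j = of_bool ((i, j) \<in> parcs (subgraph_copy (g (fst s)) (snd s)))"

lemma copy_entry_sym:
  assumes "subgraph_type (g (fst s))"
  shows "copy_entry g s i j = copy_entry g s j i"
proof -
  interpret pair_graph "g (fst s)"
    using assms by (simp add: subgraph_type_def)
  have "(b, a) \<in> parcs (g (fst s))" if "(a, b) \<in> parcs (g (fst s))" for a b
    using that arcs_symmetric by simp
  then show ?thesis
    unfolding copy_entry_def subgraph_copy_def by (auto simp: image_iff) force+
qed

text \<open>Nodes without an edge in the copy are left out. An isolated vertex of a type would add
  to the variance but not to any row of \<open>A\<^sub>w\<close>, which would spoil the comparison
  with \<open>\<Delta>\<^sub>w\<close>.\<close>

definition active_nodes :: "('t \<Rightarrow> nat pair_pre_digraph) \<Rightarrow> 't \<times> nat list \<Rightarrow> nat set" where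
  "active_nodes g s = {i. \<exists>j. (i, j) \<in> parcs (subgraph_copy (g (fst s)) (snd s))}"

text \<open>Neighbours are distinct members of the list, so a degree is at most its length: this
  gives \<open>\<beta> = M\<close>. An active node has a neighbour below \<open>n\<close>, so the
  expected number of formed copies in which a node is active is at most its row sum in the mean of
  \<open>A\<^sub>w\<close>.\<close>

lemma copy_row_sum:
  assumes type: "subgraph_type (g (fst s))" and L: "snd s \<in> node_lists n (card (pverts (g (fst s))))"
  shows "(\<Sum>j<n. copy_entry g s i j) \<le> real (card (pverts (g (fst s)))) * of_bool (i \<in> active_nodes g s)"
    and "of_bool (i \<in> active_nodes g s) \<le> (\<Sum>j<n. copy_entry g s i j)"
proof -
  interpret pair_graph "g (fst s)"
    using type by (simp add: subgraph_type_def)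
  let ?L = "snd s" and ?E = "parcs (subgraph_copy (g (fst s)) (snd s))"
  have E: "j \<in> set ?L" if "(i, j) \<in> ?E" for i j
  proof -
    from that obtain a b where "(a, b) \<in> parcs (g (fst s))" "j = ?L ! b"
      by (auto simp: subgraph_copy_def)
    moreover from this have "b < length ?L"
      using in_arcsD2 type L by (auto simp: subgraph_type_def node_lists_def)
    ultimately show ?thesis by simp
  qed
  have Ln: "set ?L \<subseteq> {..<n}" and len: "length ?L = card (pverts (g (fst s)))"
    using L by (auto simp: node_lists_def)
  have sum: "(\<Sum>j<n. copy_entry g s i j) = real (card {j. j < n \<and> (i, j) \<in> ?E})"
    by (simp add: copy_entry_def sum_of_bool_eq Int_def)
  show "(\<Sum>j<n. copy_entry g s i j) \<le> real (card (pverts (g (fst s)))) * of_bool (i \<in> active_nodes g s)"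
  proof (cases "i \<in> active_nodes g s")
    case True
    have "card {j. j < n \<and> (i, j) \<in> ?E} \<le> card (set ?L)"
      using E by (intro card_mono) auto
    also have "\<dots> \<le> card (pverts (g (fst s)))"
      using card_length[of ?L] len by simp
    finally show ?thesis using True unfolding sum by simp
  next
    case False
    then have empty: "{j. j < n \<and> (i, j) \<in> ?E} = {}" by (auto simp: active_nodes_def)
    show ?thesis unfolding sum empty by simp
  qed
  show "of_bool (i \<in> active_nodes g s) \<le> (\<Sum>j<n. copy_entry g s i j)"
  proof (cases "i \<in> active_nodes g s")
    case True
    then obtain j where "(i, j) \<in> ?E" by (auto simp: active_nodes_def)
    then have "j \<in> {j. j < n \<and> (i, j) \<in> ?E}" using E Ln by auto
    then have "0 < card {j. j < n \<and> (i, j) \<in> ?E}"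
      by (subst card_gt_0_iff) auto
    then show ?thesis using True unfolding sum by simp
  qed (simp add: sum)
qed

lemma weighted_adjacency_entry:
  assumes "finite T" "i < n" "j < n"
  shows "weighted_adjacency n T g x \<omega> $$ (i, j)
    = (\<Sum>s\<in>{s \<in> subgraph_slots n T g. x s \<omega>}. copy_entry g s i j)"
proof -
  have "weighted_adjacency n T g x \<omega> $$ (i, j)
      = (\<Sum>t\<in>T. \<Sum>L\<in>node_lists n (card (pverts (g t))). of_bool (x (t, L) \<omega>) * copy_entry g (t, L) i j)"
    using assms by (simp add: weighted_adjacency_def adjacency_matrix_def copy_entry_def)
  also have "\<dots> = (\<Sum>s\<in>subgraph_slots n T g. of_bool (x s \<omega>) * copy_entry g s i j)"
    unfolding subgraph_slots_def using assms by (subst sum.Sigma) (auto simp: finite_node_lists case_prod_beta)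
  also have "\<dots> = (\<Sum>s\<in>{s \<in> subgraph_slots n T g. x s \<omega>}. copy_entry g s i j)"
    using finite_subgraph_slots[OF assms(1)]
    by (intro sum.mono_neutral_cong_right) auto
  finally show ?thesis .
qed

lemma max_row_sum_norm_eq:
  "max_row_sum_norm (expected_matrix \<Omega> n A) = (MAX i\<in>{..<n}. \<Sum>j<n. \<bar>\<integral>\<omega>. A \<omega> $$ (i, j) \<partial>\<Omega>\<bar>)"
  unfolding max_row_sum_norm_def expected_matrix_def by (auto intro!: arg_cong[where f = Max] image_cong)

text \<open>The non-asymptotic form for one \<open>n\<close>, with \<open>t\<close> in the role of
  \<open>ln (2 * n / \<epsilon>)\<close>.\<close>

lemma uSUGM_concentration:
  fixes T :: "'t set" and g :: "'t \<Rightarrow> nat pair_pre_digraph"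
    and p :: "'t \<Rightarrow> nat list \<Rightarrow> real" and \<Omega> :: "'w measure" and x :: "'t \<times> nat list \<Rightarrow> 'w \<Rightarrow> bool"
    and M :: nat and \<mu> t :: real
  assumes types: "finite T" "\<And>t. t \<in> T \<Longrightarrow> subgraph_type (g t)" "\<And>t. t \<in> T \<Longrightarrow> card (pverts (g t)) \<le> M"
    and probs: "\<And>t L. t \<in> T \<Longrightarrow> L \<in> node_lists n (card (pverts (g t))) \<Longrightarrow> p t L \<in> {0..1}"
    and model: "sugm_formation n T g p \<Omega> x" and n: "0 < n" and t: "0 < t"
  defines "A\<^sub>u \<equiv> unweighted_adjacency n T g x"
  defines "\<Delta>\<^sub>w \<equiv> max_row_sum_norm (expected_matrix \<Omega> n (weighted_adjacency n T g x))"
    and "\<Delta>\<^sub>u \<equiv> max_row_sum_norm (expected_matrix \<Omega> n A\<^sub>u)"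
  assumes ratio: "\<Delta>\<^sub>w / \<Delta>\<^sub>u \<le> \<mu>" and large: "\<Delta>\<^sub>u > 16 / \<mu> * t"
  shows "measure \<Omega> {\<omega> \<in> space \<Omega>. spectral_norm (A\<^sub>u \<omega> - expected_matrix \<Omega> n A\<^sub>u)
      \<le> 4 * real M ^ 2 * sqrt (\<mu> * \<Delta>\<^sub>u * t)} \<ge> 1 - 2 * real n * exp (- t)"
proof -
  define J where "J = subgraph_slots n T g"
  define q where "q s = p (fst s) (snd s)" for s
  define W where "W S i j = (\<Sum>s\<in>S. copy_entry g s i j)" for S i j
  define U where "U S i j = min (W S i j) 1" for S i j
  define formed where "formed \<omega> = {s \<in> J. x s \<omega>}" for \<omega>
  interpret prob_space \<Omega>
    using model by (simp add: sugm_formation_def)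
  have J: "finite J"
    unfolding J_def by (rule finite_subgraph_slots[OF types(1)])
  have slot: "subgraph_type (g (fst s))" "snd s \<in> node_lists n (card (pverts (g (fst s))))"
    "card (pverts (g (fst s))) \<le> M" if "s \<in> J" for s
    using that types by (auto simp: J_def subgraph_slots_def)
  have q: "q s \<in> {0..1}" if "s \<in> J" for s
    using that probs by (auto simp: J_def subgraph_slots_def q_def)
  have indep: "indep_vars (\<lambda>_. count_space UNIV) x J"
    using model by (simp add: sugm_formation_def J_def)
  have distr: "distr \<Omega> (count_space UNIV) (x s) = measure_pmf (bernoulli_pmf (q s))" if "s \<in> J" for s
    using model that by (auto simp: sugm_formation_def J_def q_def)
  note law = J q indep distr
  have a0: "0 \<le> copy_entry g s i j" for s i j by (simp add: copy_entry_def)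
  have Aw: "weighted_adjacency n T g x \<omega> $$ (i, j) = W (formed \<omega>) i j" if "i < n" "j < n" for \<omega> i j
    using weighted_adjacency_entry[OF types(1) that] by (simp add: W_def formed_def J_def)
  have Au: "A\<^sub>u \<omega> $$ (i, j) = U (formed \<omega>) i j" if "i < n" "j < n" for \<omega> i j
    using that by (simp add: A\<^sub>u_def unweighted_adjacency_def Aw U_def)
  have EU: "(\<integral>\<omega>. A\<^sub>u \<omega> $$ (i, j) \<partial>\<Omega>) = bernoulli_mean q J (\<lambda>S. U S i j)" if "i < n" "j < n" for i j
    unfolding Au[OF that] formed_def by (rule expectation_formed_set[OF law])
  have EW: "(\<integral>\<omega>. weighted_adjacency n T g x \<omega> $$ (i, j) \<partial>\<Omega>) = bernoulli_mean q J (\<lambda>S. W S i j)"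
    if "i < n" "j < n" for i j
    unfolding Aw[OF that] formed_def by (rule expectation_formed_set[OF law])
  have W0: "0 \<le> W S i j" for S i j
    unfolding W_def by (intro sum_nonneg a0)
  have EU0: "0 \<le> bernoulli_mean q J (\<lambda>S. U S i j)" for i j
    using bernoulli_mean_mono[of J q "\<lambda>_. 0" "\<lambda>S. U S i j"] q W0
    by (simp add: bernoulli_mean_const[OF J] U_def)
  have EUW: "bernoulli_mean q J (\<lambda>S. U S i j) \<le> bernoulli_mean q J (\<lambda>S. W S i j)" for i j
    using q by (intro bernoulli_mean_mono) (auto simp: U_def)
  have EW0: "0 \<le> bernoulli_mean q J (\<lambda>S. W S i j)" for i j
    using EU0 EUW by (rule order.trans)
  have EWsum: "bernoulli_mean q J (\<lambda>S. W S i j) = (\<Sum>s\<in>J. q s * copy_entry g s i j)" for i j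
  proof -
    have "bernoulli_mean q J (\<lambda>S. W S i j)
        = bernoulli_mean q J (\<lambda>S. \<Sum>s\<in>J. copy_entry g s i j * of_bool (s \<in> S))"
      unfolding W_def using J by (intro bernoulli_mean_cong sum.mono_neutral_cong_left) auto
    also have "\<dots> = (\<Sum>s\<in>J. copy_entry g s i j * q s)"
      by (simp add: bernoulli_mean_sum bernoulli_mean_cmult bernoulli_mean_member[OF J] cong: sum.cong)
    finally show ?thesis by (simp add: mult.commute)
  qed
  have \<Delta>\<^sub>w: "\<Delta>\<^sub>w = (MAX i\<in>{..<n}. \<Sum>j<n. bernoulli_mean q J (\<lambda>S. W S i j))"
    unfolding \<Delta>\<^sub>w_def max_row_sum_norm_eq using EW0
    by (intro arg_cong[where f = Max] image_cong sum.cong) (auto simp: EW)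
  have \<Delta>\<^sub>u: "\<Delta>\<^sub>u = (MAX i\<in>{..<n}. \<Sum>j<n. bernoulli_mean q J (\<lambda>S. U S i j))"
    unfolding \<Delta>\<^sub>u_def max_row_sum_norm_eq using EU0
    by (intro arg_cong[where f = Max] image_cong sum.cong) (auto simp: EU)
  have row_w: "(\<Sum>j<n. bernoulli_mean q J (\<lambda>S. W S i j)) \<le> \<Delta>\<^sub>w" if "i < n" for i
    unfolding \<Delta>\<^sub>w using that by (intro Max_ge) auto
  have "0 \<le> (\<Sum>j<n. bernoulli_mean q J (\<lambda>S. U S 0 j))"
    using EU0 by (intro sum_nonneg)
  also have "\<dots> \<le> \<Delta>\<^sub>u"
    unfolding \<Delta>\<^sub>u using n by (intro Max_ge) auto
  finally have \<Delta>\<^sub>u0: "0 \<le> \<Delta>\<^sub>u" .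
  have \<Delta>\<^sub>uw: "\<Delta>\<^sub>u \<le> \<Delta>\<^sub>w"
  proof -
    have "(\<Sum>j<n. bernoulli_mean q J (\<lambda>S. U S i j)) \<le> \<Delta>\<^sub>w" if "i < n" for i
      using sum_mono[of "{..<n}", OF EUW] row_w[OF that] by (rule order.trans)
    then show ?thesis
      unfolding \<Delta>\<^sub>u using n by (intro Max.boundedI) auto
  qed
  \<comment> \<open>Division by 0 yields 0, so \<open>ratio\<close> alone gives only
    \<open>0 \<le> \<mu>\<close>. If \<open>\<mu> = 0\<close>, then \<open>large\<close> reads
    \<open>0 < \<Delta>\<^sub>u\<close>, and the ratio is positive because
    \<open>\<Delta>\<^sub>u \<le> \<Delta>\<^sub>w\<close>.\<close>
  have \<mu>: "0 < \<mu>"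
  proof (rule ccontr)
    assume "\<not> 0 < \<mu>"
    moreover have "0 \<le> \<mu>"
      using ratio \<Delta>\<^sub>u0 \<Delta>\<^sub>uw by (meson divide_nonneg_nonneg order.trans)
    ultimately have "\<mu> = 0" by simp
    with large have "0 < \<Delta>\<^sub>u" by simp
    with \<Delta>\<^sub>uw have "0 < \<Delta>\<^sub>w / \<Delta>\<^sub>u" by simp
    with ratio \<open>\<mu> = 0\<close> show False by simp
  qed
  have "0 < 16 / \<mu> * t" using \<mu> t by simp
  with large have \<Delta>\<^sub>u: "0 < \<Delta>\<^sub>u" by linarith
  \<comment> \<open>The variance proxy: \<open>ratio\<close> gives
    \<open>\<Delta>\<^sub>w \<le> v\<close>, and \<open>large\<close> gives
    \<open>16 * t < v\<close>.\<close>
  define v where "v = \<mu> * \<Delta>\<^sub>u"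
  have v: "0 < v" "16 * t < v" "\<Delta>\<^sub>w \<le> v"
    using \<mu> \<Delta>\<^sub>u large ratio by (simp_all add: v_def field_simps)
  \<comment> \<open>\<open>M = 0\<close> would force \<open>T\<close> to be empty, as an edge needs
    a vertex, and then \<open>\<Delta>\<^sub>w\<close> would be 0.\<close>
  have M: "1 \<le> M"
  proof (rule ccontr)
    assume "\<not> 1 \<le> M"
    then have "card (pverts (g s)) = 0" if "s \<in> T" for s
      using types(3)[OF that] by simp
    moreover have "card (pverts (g s)) \<noteq> 0" if "s \<in> T" for s
    proof
      assume "card (pverts (g s)) = 0"
      then have "pverts (g s) = {}" "parcs (g s) \<noteq> {}" "pair_graph (g s)"
        using types(2)[OF that] by (auto simp: subgraph_type_def)
      then interpret pair_graph "g s" by simp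
      show False
        using in_arcsD1 \<open>pverts (g s) = {}\<close> \<open>parcs (g s) \<noteq> {}\<close> by fastforce
    qed
    ultimately have "T = {}" by auto
    then have "J = {}" by (simp add: J_def subgraph_slots_def)
    then have "W {} i j = 0" for i j by (simp add: W_def)
    with \<open>J = {}\<close> have "\<Delta>\<^sub>w = (MAX i\<in>{..<n}. 0)"
      unfolding \<Delta>\<^sub>w by simp
    also have "\<dots> = 0" using n by (simp add: image_constant_conv lessThan_empty_iff)
    finally show False using \<Delta>\<^sub>u \<Delta>\<^sub>uw by simp
  qed
  \<comment> \<open>This minimizes \<open>(t + 4 * \<theta>^2 * M^2 * v) / \<theta>\<close>: the two
    summands become equal, with sum \<open>2 * t\<close>.\<close>
  define \<theta> where "\<theta> = sqrt (t / (4 * v)) / real M"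
  have \<theta>: "0 < \<theta>" using t v M by (simp add: \<theta>_def)
  have \<theta>M: "\<theta> * real M = sqrt (t / (4 * v))" using M by (simp add: \<theta>_def)
  then have \<theta>M2: "\<theta>\<^sup>2 * (real M)\<^sup>2 = t / (4 * v)"
    using t v by (simp flip: power_mult_distrib)
  have "t / (4 * v) \<le> (1 / 4)\<^sup>2"
    using v t by (simp add: divide_le_eq power2_eq_square)
  then have \<theta>M4: "\<theta> * real M \<le> 1 / 4"
    unfolding \<theta>M by (intro real_le_lsqrt) simp_all
  define r where "r = 4 * real M ^ 2 * sqrt (v * t)"
  have "\<theta> * (4 * real M * sqrt (v * t)) = 4 * (sqrt (t / (4 * v)) * sqrt (v * t))"
    using \<theta>M by (simp add: mult_ac)
  also have "\<dots> = 2 * t"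
  proof -
    have "sqrt (t / (4 * v)) * sqrt (v * t) = sqrt ((t / 2)\<^sup>2)"
      using v by (simp add: power2_eq_square flip: real_sqrt_mult)
    then have "sqrt (t / (4 * v)) * sqrt (v * t) = t / 2" using t by simp
    then show ?thesis by (simp only:)
  qed
  finally have "2 * t = \<theta> * (4 * real M * sqrt (v * t))" by simp
  also have "\<dots> \<le> \<theta> * r"
  \<comment> \<open>The optimization yields \<open>4 * M * sqrt (v * t)\<close>; the power
    \<open>M^2\<close> in \<open>r\<close> enters through \<open>M \<le> M^2\<close>.\<close>
  proof -
    have "real M * 1 \<le> real M * real M" using M by (intro mult_left_mono) simp_all
    then have "real M \<le> real M ^ 2" by (simp add: power2_eq_square)
    then show ?thesis
      unfolding r_def using \<theta> v t by (intro mult_left_mono mult_right_mono) simp_all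
  qed
  finally have \<theta>r: "t + 4 * \<theta>\<^sup>2 * (real M)\<^sup>2 * v \<le> \<theta> * r"
    using \<theta>M2 v by (simp add: field_simps)
  have r0: "0 \<le> r" using v t by (simp add: r_def)
  have deviation: "mat n n (\<lambda>(i, j). U (formed \<omega>) i j - bernoulli_mean q J (\<lambda>S. U S i j))
      = A\<^sub>u \<omega> - expected_matrix \<Omega> n A\<^sub>u" for \<omega>
    by (intro eq_matI) (auto simp: expected_matrix_def EU simp flip: Au)
  have "1 - 2 * real n * exp (- t) \<le> bernoulli_mean q J (\<lambda>S. of_bool (spectral_norm
      (mat n n (\<lambda>(i, j). U S i j - bernoulli_mean q J (\<lambda>S. U S i j))) \<le> r))"
  proof (rule spectral_norm_tail[where a = "copy_entry g" and P = "active_nodes g", OF J q \<theta> _ \<theta>M4])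
    show "copy_entry g s i j = copy_entry g s j i" if "s \<in> J" for s i j
      using slot(1)[OF that] by (rule copy_entry_sym)
    then show "U S i j = U S j i" if "S \<subseteq> J" for S i j
      using that by (auto simp: U_def W_def intro!: arg_cong[where f = "\<lambda>y. min y 1"] sum.cong)
    \<comment> \<open>Truncation at 1 is monotone and 1-Lipschitz, so the change lies between 0 and
      the entry of the added copy.\<close>
    show "\<bar>U (insert s S) i j - U S i j\<bar> \<le> copy_entry g s i j" if "s \<in> J" "S \<subseteq> J - {s}" for s S i j
    proof -
      have "finite S" "s \<notin> S" using that J by (auto intro: finite_subset)
      then have "W (insert s S) i j = copy_entry g s i j + W S i j" by (simp add: W_def)
      then show ?thesis using a0[of s i j] by (simp add: U_def min_def)
    qed
    show "(\<Sum>j<n. copy_entry g s i j) \<le> real M * of_bool (i \<in> active_nodes g s)" if "s \<in> J" for s i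
      using copy_row_sum(1)[of g s n i] slot[OF that]
      by (auto simp: of_bool_def split: if_splits)
    show "(\<Sum>s\<in>J. q s * of_bool (i \<in> active_nodes g s)) \<le> v" if "i < n" for i
    proof -
      have "(\<Sum>s\<in>J. q s * of_bool (i \<in> active_nodes g s)) \<le> (\<Sum>s\<in>J. q s * (\<Sum>j<n. copy_entry g s i j))"
        using q by (intro sum_mono mult_left_mono copy_row_sum(2) slot) auto
      also have "\<dots> = (\<Sum>j<n. bernoulli_mean q J (\<lambda>S. W S i j))"
        unfolding EWsum sum_distrib_left by (rule sum.swap)
      also have "\<dots> \<le> v" using row_w[OF that] v by simp
      finally show ?thesis .
    qed
  qed (use t r0 \<theta>r in auto)
  also have "\<dots> = prob {\<omega> \<in> space \<Omega>. spectral_norm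
      (mat n n (\<lambda>(i, j). U (formed \<omega>) i j - bernoulli_mean q J (\<lambda>S. U S i j))) \<le> r}"
    unfolding formed_def by (rule prob_formed_set[OF law, symmetric])
  finally show ?thesis
    unfolding deviation by (simp only: r_def v_def)
qed

theorem proposition3p5:
  fixes T :: "'t set" and g :: "'t \<Rightarrow> nat pair_pre_digraph"
    and p :: "nat \<Rightarrow> 't \<Rightarrow> nat list \<Rightarrow> real"
    and \<Omega> :: "nat \<Rightarrow> 'w measure" and x :: "nat \<Rightarrow> 't \<times> nat list \<Rightarrow> 'w \<Rightarrow> bool"
    and A\<^sub>w A\<^sub>u :: "nat \<Rightarrow> 'w \<Rightarrow> real mat" and \<Delta>\<^sub>w \<Delta>\<^sub>u :: "nat \<Rightarrow> real"
    and M :: nat and \<mu> \<epsilon> :: real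
  assumes types: "finite T" "T \<noteq> {}" "\<And>t. t \<in> T \<Longrightarrow> subgraph_type (g t)"
    and probs: "\<And>n t L. t \<in> T \<Longrightarrow> L \<in> node_lists n (card (pverts (g t))) \<Longrightarrow> p n t L \<in> {0..1}"
    and model: "\<And>n. sugm_formation n T g (p n) (\<Omega> n) (x n)"
    and A\<^sub>w: "\<And>n. A\<^sub>w n = weighted_adjacency n T g (x n)"
    and A\<^sub>u: "\<And>n. A\<^sub>u n = unweighted_adjacency n T g (x n)"
    and \<Delta>\<^sub>w: "\<And>n. \<Delta>\<^sub>w n = max_row_sum_norm (expected_matrix (\<Omega> n) n (A\<^sub>w n))"
    and \<Delta>\<^sub>u: "\<And>n. \<Delta>\<^sub>u n = max_row_sum_norm (expected_matrix (\<Omega> n) n (A\<^sub>u n))"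
    and M: "M = (MAX t \<in> T. card (pverts (g t)))"
    and "\<epsilon> > 0"
    and "\<forall>\<^sub>F n in sequentially. \<Delta>\<^sub>w n / \<Delta>\<^sub>u n \<le> \<mu>"
    and "\<forall>\<^sub>F n in sequentially. \<Delta>\<^sub>u n > 16 / \<mu> * ln (2 * real n / \<epsilon>)"
  shows "\<forall>\<^sub>F n in sequentially.
    measure (\<Omega> n) {\<omega> \<in> space (\<Omega> n).
      spectral_norm (A\<^sub>u n \<omega> - expected_matrix (\<Omega> n) n (A\<^sub>u n))
        \<le> 4 * real M ^ 2 * sqrt (\<mu> * \<Delta>\<^sub>u n * ln (2 * real n / \<epsilon>))} \<ge> 1 - \<epsilon>"
  using assms(12,13) eventually_gt_at_top[of "nat \<lceil>\<epsilon>\<rceil>"]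
proof eventually_elim
  case (elim n)
  \<comment> \<open>This choice makes the failure probability \<open>2 * n * exp (- t)\<close> equal
    to \<open>\<epsilon>\<close>; restricting to \<open>n > \<epsilon>\<close> ensures
    \<open>0 < t\<close>.\<close>
  define t where "t = ln (2 * real n / \<epsilon>)"
  have "real (nat \<lceil>\<epsilon>\<rceil>) < real n" using elim(3) by simp
  then have n\<epsilon>: "\<epsilon> < real n" by linarith
  then have n: "0 < n" using \<open>\<epsilon> > 0\<close> by (intro Nat.gr0I) simp
  have "1 < 2 * real n / \<epsilon>" using n\<epsilon> \<open>\<epsilon> > 0\<close> by (simp add: less_divide_eq)
  then have t: "0 < t" by (simp add: t_def)
  have "exp (- t) = \<epsilon> / (2 * real n)"
    using n \<open>\<epsilon> > 0\<close> by (simp add: t_def exp_minus)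
  then have tail: "2 * real n * exp (- t) = \<epsilon>" using n by simp
  have sizes: "card (pverts (g s)) \<le> M" if "s \<in> T" for s
    unfolding M using types(1) that by (intro Max_ge) auto
  note model_eqs = \<Delta>\<^sub>w \<Delta>\<^sub>u A\<^sub>w A\<^sub>u
  show ?case
    using uSUGM_concentration[OF types(1,3) sizes probs model n t elim(1)[unfolded model_eqs]
        elim(2)[unfolded model_eqs, folded t_def]]
    unfolding model_eqs tail unfolding t_def .
qed

end
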